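(* Let $R(z,w)\not\equiv 0$ be an irreducible rational function in $w$ whose coefficients are rational functions of $z$, and let $a(z)$ be a rational function. Suppose that the equation $$w(z+1)-w(z-1)+a(z)\frac{w'(z)}{w(z)}=R(z,w(z))$$ admits a transcendental entire solution $w(z)$ with $\sigma_2(w)<1$. Then the equation reduces to one of the following two forms: $$w(z+1)-w(z-1)+a(z)\frac{w'(z)}{w(z)}=a_1(z)w(z)+a_0(z),$$ or $$w(z+1)-w(z-1)+a(z)\frac{w'(z)}{w(z)}=\frac{a_2(z)w(z)^2+a_1(z)w(z)+a_0(z)}{w(z)},$$ where $a_2(z),a_1(z),a_0(z)$ are rational functions; that is, as a rational function in $w$, either $R(z,w)=a_1(z)w+a_0(z)$ or $R(z,w)=\dfrac{a_2(z)w^2+a_1(z)w+a_0(z)}{w}$ for some rational functions $a_2,a_1,a_0$ of $z$.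
   Context: All rational functions of $z$ are over $\mathbb{C}$ and may be identically zero unless stated otherwise. $R(z,w)=P(z,w)/Q(z,w)$ with $P,Q$ polynomials in $w$ whose coefficients are rational functions of $z$; irreducible means that $P$ and $Q$ have no common factor as polynomials in $w$ over $\mathbb{C}(z)$. The hyper-order of a meromorphic function $w$ in the complex plane is $\sigma_2(w)=\limsup_{r\to\infty}\frac{\log\log T(r,w)}{\log r}$, where $T(r,w)$ is the Nevanlinna characteristic. A solution of the equation is a function satisfying it identically as an identity of meromorphic functions. *)

theory Defs
  imports
    "HOL-Complex_Analysis.Complex_Analysis"
    "HOL-Computational_Algebra.Computational_Algebra"
    "HOL-Computational_Algebra.Field_as_Ring"
begin

type_synonym ratfun = "complex poly fract"

text \<open>The value at a point is taken from the representation in lowest terms. At the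
  (finitely many) poles it is \<open>0\<close>, as for division in HOL.\<close>

definition ratfun_eval :: "ratfun \<Rightarrow> complex \<Rightarrow> complex" where
  "ratfun_eval r z = poly (fst (quot_of_fract r)) z / poly (snd (quot_of_fract r)) z"

lemma ratfun_eval_Fract:
  assumes "poly q z \<noteq> 0"
  shows "ratfun_eval (Fraction_Field.Fract p q) z = poly p z / poly q z"
proof -
  have "q \<noteq> 0" using assms by auto
  then obtain d where d: "p = fst (normalize_quot (p, q)) * d" "q = snd (normalize_quot (p, q)) * d"
    using normalize_quotE by blast
  have "quot_of_fract (Fraction_Field.Fract p q) = normalize_quot (p, q)"
    using quot_of_fract_quot_to_fract[of "(p, q)"] by (simp add: quot_to_fract_def)
  moreover have "poly p z = poly (fst (normalize_quot (p, q))) z * poly d z"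
      and "poly q z = poly (snd (normalize_quot (p, q))) z * poly d z"
    by (metis d(1) poly_mult, metis d(2) poly_mult)
  ultimately show ?thesis
    using assms by (simp add: ratfun_eval_def)
qed

text \<open>Polynomials in the second variable \<open>w\<close> with rational functions of \<open>z\<close> as coefficients.\<close>

definition eval2 :: "ratfun poly \<Rightarrow> complex \<Rightarrow> complex \<Rightarrow> complex" where
  "eval2 P z w = poly (map_poly (\<lambda>c. ratfun_eval c z) P) w"

text \<open>Equality off a sparse set is equality of meromorphic functions.\<close>

definition transcendental :: "(complex \<Rightarrow> complex) \<Rightarrow> bool" where
  "transcendental f \<longleftrightarrow> \<not> (\<exists>r. \<forall>\<^sub>\<approx>z\<in>UNIV. f z = ratfun_eval r z)"

text \<open>The Nevanlinna characteristic of a function meromorphic in the plane.\<close>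

definition log_plus :: "real \<Rightarrow> real" where
  "log_plus x = (if x > 0 then max 0 (ln x) else 0)"

definition proximity :: "(complex \<Rightarrow> complex) \<Rightarrow> real \<Rightarrow> real" where
  "proximity f r =
     integral {0..2 * pi} (\<lambda>\<theta>. log_plus (norm (f (rcis r \<theta>)))) / (2 * pi)"

text \<open>Poles are counted with multiplicity; \<open>zorder\<close> is negative at a pole.\<close>

definition pole_count :: "(complex \<Rightarrow> complex) \<Rightarrow> real \<Rightarrow> real" where
  "pole_count f t = (\<Sum>z | norm z \<le> t \<and> is_pole f z. real_of_int (- zorder f z))"

definition pole_counting :: "(complex \<Rightarrow> complex) \<Rightarrow> real \<Rightarrow> real" where
  "pole_counting f r =
     integral {0..r} (\<lambda>t. (pole_count f t - pole_count f 0) / t) + pole_count f 0 * ln r"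

definition nevanlinna_T :: "(complex \<Rightarrow> complex) \<Rightarrow> real \<Rightarrow> real" where
  "nevanlinna_T f r = proximity f r + pole_counting f r"

text \<open>For nonconstant \<open>f\<close> the characteristic is unbounded, so \<open>ln (ln T)\<close> has its usual
  meaning for all large \<open>r\<close>.\<close>

definition hyper_order :: "(complex \<Rightarrow> complex) \<Rightarrow> ereal" where
  "hyper_order f = Limsup at_top (\<lambda>r. ereal (ln (ln (nevanlinna_T f r)) / ln r))"

end

theory Submission
  imports Defs "HOL-Real_Asymp.Real_Asymp"
begin

text \<open>Multiplying by \<open>w\<close>, the equation says that the function
  \<open>F(z) = w(z) (w(z+1) - w(z-1)) + a(z) w'(z)\<close> equals \<open>P\<^sub>1(z,w) / Q\<^sub>1(z,w)\<close>, the reduced form of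
  \<open>w R(z,w)\<close>. The claim is that \<open>Q\<^sub>1\<close> is constant in \<open>w\<close> and \<open>P\<^sub>1\<close> has degree at most \<open>2\<close> in \<open>w\<close>.

  If \<open>Q\<^sub>1\<close> is constant and \<open>deg P\<^sub>1 \<ge> 3\<close>, then wherever \<open>|w(z)|\<close> exceeds a large power of \<open>|z|\<close>
  it is at most about the square root of the maximum of \<open>|w|\<close> on the unit disc around \<open>z\<close>.
  Iterating, \<open>log |w|\<close> grows exponentially, contradicting hyper-order less than \<open>1\<close>.

  If \<open>Q\<^sub>1\<close> is not constant, a Bezout identity shows that \<open>Q\<^sub>1(z,w(z))\<close> has no zeros near infinity,
  hence equals \<open>r e\<^sup>g\<close> with \<open>r\<close> rational and \<open>g\<close> entire. By Harnack's inequality, at a point where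
  \<open>- Re g\<close> exceeds a large multiple of \<open>log |z|\<close>, either it grows by the factor \<open>3/2\<close> within distance
  \<open>3\<close>, or it stays large on a unit disc. In the latter case \<open>Q\<^sub>1(z,w)\<close> is tiny there, so \<open>w\<close> and
  \<open>F\<close> are polynomially bounded, which contradicts the Bezout identity. So the first alternative
  always holds, and the same iteration bounds \<open>- Re g\<close> by a multiple of \<open>log |z|\<close>. Then \<open>g\<close> is
  constant and \<open>w\<close> is algebraic, hence rational.\<close>

subsection \<open>Poisson formula and Harnack inequality\<close>

text \<open>Cauchy's integral formula at z is applied to the product of H with K(u) = (R^2 - |z|^2)
  / (R^2 - cnj z u). The factor K has no pole in the closed disc and takes the value 1 at z. On the
  circle R^2 = u cnj u, so u K(u) / (u - z) is exactly the Poisson kernel.\<close>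

lemma Poisson_formula:
  fixes H :: "complex \<Rightarrow> complex"
  assumes "continuous_on (cball 0 R) H" and "H holomorphic_on ball 0 R" and "norm z < R"
  shows "((\<lambda>\<theta>. H (rcis R \<theta>) * of_real ((R\<^sup>2 - (norm z)\<^sup>2) / (norm (rcis R \<theta> - z))\<^sup>2))
           has_integral 2 * of_real pi * H z) {0..2 * pi}"
proof -
  have R: "R > 0" using assms(3) norm_ge_zero[of z] by linarith
  define K where "K = (\<lambda>u. of_real (R\<^sup>2 - (norm z)\<^sup>2) / (of_real (R\<^sup>2) - cnj z * u))"
  have nz: "of_real (R\<^sup>2) - cnj z * u \<noteq> 0" if "norm u \<le> R" for u
  proof
    assume "of_real (R\<^sup>2) - cnj z * u = 0"
    then have "norm (cnj z * u) = norm (of_real (R\<^sup>2) :: complex)" by simp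
    then have "norm z * norm u = R\<^sup>2" using R by (simp add: norm_mult del: of_real_power)
    moreover have "norm z * norm u \<le> norm z * R" using that by (intro mult_left_mono) auto
    moreover have "norm z * R < R * R" using assms(3) R by simp
    ultimately show False by (simp add: power2_eq_square)
  qed
  have Kc: "continuous_on (cball 0 R) (\<lambda>u. H u * K u)"
    unfolding K_def by (intro continuous_intros assms(1)) (use nz in auto)
  have Kh: "(\<lambda>u. H u * K u) holomorphic_on ball 0 R"
    unfolding K_def by (intro holomorphic_intros assms(2)) (use nz in auto)
  have Kz: "K z = 1"
  proof -
    have "cnj z * z = of_real ((norm z)\<^sup>2)"
      by (metis complex_norm_square mult.commute of_real_power)
    moreover have "of_real (R\<^sup>2) - cnj z * z \<noteq> 0" using nz[of z] assms(3) by simp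
    ultimately show ?thesis by (simp add: K_def)
  qed
  have "((\<lambda>u. H u * K u / (u - z)) has_contour_integral 2 * of_real pi * \<i> * (H z * K z)) (circlepath 0 R)"
    using Cauchy_integral_circlepath[OF Kc Kh, of z] assms(3) by simp
  then have "((\<lambda>t. H (0 + of_real R * cis t) * K (0 + of_real R * cis t) / (0 + of_real R * cis t - z) * R * \<i> * cis t)
      has_integral (2 * of_real pi * \<i> * H z)) {0..2 * pi}"
    unfolding circlepath_def by (subst (asm) has_contour_integral_part_circlepath_iff) (auto simp: Kz)
  from has_integral_mult_right[OF this, of "-\<i>"]
  have "((\<lambda>t. -\<i> * (H (of_real R * cis t) * K (of_real R * cis t) / (of_real R * cis t - z) * R * \<i> * cis t))
      has_integral (2 * of_real pi * H z)) {0..2 * pi}" by (simp add: algebra_simps)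
  moreover have "-\<i> * (H (of_real R * cis t) * K (of_real R * cis t) / (of_real R * cis t - z) * R * \<i> * cis t)
       = H (rcis R t) * of_real ((R\<^sup>2 - (norm z)\<^sup>2) / (norm (rcis R t - z))\<^sup>2)" for t
  proof -
    define u where "u = rcis R t"
    have nu: "norm u = R" using R by (simp add: u_def)
    have uu: "u * cnj u = of_real (R\<^sup>2)"
      using complex_norm_square[of u] nu by simp
    have "u \<noteq> 0" using nu R by auto
    have "u - z \<noteq> 0" using nu assms(3) by auto
    then have c: "cnj u - cnj z \<noteq> 0" by (metis complex_cnj_diff complex_cnj_zero_iff)
    have "of_real (R\<^sup>2) - cnj z * u = u * (cnj u - cnj z)"
      using uu by (simp add: algebra_simps)
    then have "K u / (u - z) * u = of_real (R\<^sup>2 - (norm z)\<^sup>2) / ((u - z) * cnj (u - z))"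
      unfolding K_def \<open>of_real (R\<^sup>2) - cnj z * u = u * (cnj u - cnj z)\<close>
      using \<open>u \<noteq> 0\<close> by simp
    also have "(u - z) * cnj (u - z) = of_real ((norm (u - z))\<^sup>2)"
      by (metis complex_norm_square of_real_power)
    finally have *: "K u / (u - z) * u = of_real ((R\<^sup>2 - (norm z)\<^sup>2) / (norm (u - z))\<^sup>2)" by simp
    have u: "of_real R * cis t = u" by (simp add: u_def rcis_def)
    have "-\<i> * (H u * K u / (u - z) * R * \<i> * cis t) = H u * (K u / (u - z) * (of_real R * cis t))"
      by (simp add: field_simps)
    then show ?thesis unfolding u * by (simp only: u_def)
  qed
  ultimately show ?thesis by simp
qed

text \<open>Both bounds come from R^2 - |z|^2 = (R + |z|) (R - |z|) and |u - z| \<ge> R -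
  |z|.\<close>

lemma Poisson_kernel_bounds:
  fixes u z :: complex
  assumes "norm u = R" "norm z < R"
  shows "0 \<le> (R\<^sup>2 - (norm z)\<^sup>2) / (norm (u - z))\<^sup>2"
    and "(R\<^sup>2 - (norm z)\<^sup>2) / (norm (u - z))\<^sup>2 \<le> (R + norm z) / (R - norm z)"
proof -
  have R: "0 < R" using assms norm_ge_zero[of z] by linarith
  have d: "R - norm z \<le> norm (u - z)" using norm_triangle_ineq2[of u z] assms by simp
  have sq: "R\<^sup>2 - (norm z)\<^sup>2 = (R + norm z) * (R - norm z)" by (simp add: power2_eq_square algebra_simps)
  have p: "0 \<le> R\<^sup>2 - (norm z)\<^sup>2" unfolding sq using assms R by simp
  then show "0 \<le> (R\<^sup>2 - (norm z)\<^sup>2) / (norm (u - z))\<^sup>2" by simp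
  have "(R\<^sup>2 - (norm z)\<^sup>2) / (norm (u - z))\<^sup>2 \<le> (R\<^sup>2 - (norm z)\<^sup>2) / (R - norm z)\<^sup>2"
    using p d assms(2) by (intro divide_left_mono power_mono mult_pos_pos) auto
  also have "\<dots> = (R + norm z) / (R - norm z)"
    unfolding sq using assms(2) by (simp add: power2_eq_square)
  finally show "(R\<^sup>2 - (norm z)\<^sup>2) / (norm (u - z))\<^sup>2 \<le> (R + norm z) / (R - norm z)" .
qed

text \<open>In the Poisson integral the boundary values are first replaced by the majorant
  \<open>\<phi>\<close>. Since \<open>\<phi>\<close> is nonnegative, the kernel may then be replaced
  by its largest value.\<close>

lemma Re_le_circle_mean:
  assumes "continuous_on (cball 0 R) H" and "H holomorphic_on ball 0 R" and "norm z < R"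
    and "continuous_on {0..2 * pi} \<phi>"
    and "\<And>\<theta>. 0 \<le> \<phi> \<theta>" and "\<And>\<theta>. Re (H (rcis R \<theta>)) \<le> \<phi> \<theta>"
  shows "Re (H z) \<le> (R + norm z) / (R - norm z) * (integral {0..2 * pi} \<phi> / (2 * pi))"
proof -
  have R: "0 < R" using assms(3) norm_ge_zero[of z] by linarith
  define k where "k = (\<lambda>\<theta>. (R\<^sup>2 - (norm z)\<^sup>2) / (norm (rcis R \<theta> - z))\<^sup>2)"
  have kb: "0 \<le> k \<theta>" "k \<theta> \<le> (R + norm z) / (R - norm z)" for \<theta>
    using Poisson_kernel_bounds[of "rcis R \<theta>" R z] assms(3) R by (auto simp: k_def)
  have "((\<lambda>\<theta>. Re (H (rcis R \<theta>) * of_real (k \<theta>))) has_integral Re (2 * of_real pi * H z)) {0..2 * pi}"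
    unfolding k_def by (rule has_integral_Re[OF Poisson_formula[OF assms(1-3)]])
  moreover have "\<phi> integrable_on {0..2 * pi}"
    using assms(4) by (rule integrable_continuous_interval)
  then have "((\<lambda>\<theta>. (R + norm z) / (R - norm z) * \<phi> \<theta>) has_integral
       ((R + norm z) / (R - norm z) * integral {0..2 * pi} \<phi>)) {0..2 * pi}"
    by (intro has_integral_mult_right) (simp add: has_integral_integral)
  ultimately have "Re (2 * of_real pi * H z) \<le> (R + norm z) / (R - norm z) * integral {0..2 * pi} \<phi>"
  proof (rule has_integral_le)
    fix \<theta>
    have "Re (H (rcis R \<theta>) * of_real (k \<theta>)) = Re (H (rcis R \<theta>)) * k \<theta>" by simp
    also have "\<dots> \<le> \<phi> \<theta> * k \<theta>" using assms(6) kb by (intro mult_right_mono) auto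
    also have "\<dots> \<le> \<phi> \<theta> * ((R + norm z) / (R - norm z))" using assms(5) kb by (intro mult_left_mono) auto
    finally show "Re (H (rcis R \<theta>) * of_real (k \<theta>)) \<le> (R + norm z) / (R - norm z) * \<phi> \<theta>"
      by (simp add: mult.commute)
  qed
  then have "2 * pi * Re (H z) \<le> 2 * pi * ((R + norm z) / (R - norm z) * (integral {0..2 * pi} \<phi> / (2 * pi)))"
    by simp
  then show ?thesis by (rule mult_left_le_imp_le) simp
qed

text \<open>After translating c to 0, the majorant in \<open>Re_le_circle_mean\<close> is the real
  part itself, which is nonnegative on the circle and whose mean is its value at the centre.\<close>

lemma Harnack_upper:
  assumes "H holomorphic_on UNIV" and "norm (z - c) < R"
    and "\<And>u. norm (u - c) = R \<Longrightarrow> 0 \<le> Re (H u)"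
  shows "Re (H z) \<le> (R + norm (z - c)) / (R - norm (z - c)) * Re (H c)"
proof -
  have R: "0 < R" using assms(2) norm_ge_zero[of "z - c"] by linarith
  define G where "G = (\<lambda>u. H (c + u))"
  have G: "G holomorphic_on A" for A
    unfolding G_def
    by (rule holomorphic_on_compose_gen[OF _ assms(1), unfolded o_def]) (auto intro!: holomorphic_intros)
  have Gc: "continuous_on A G" for A by (rule holomorphic_on_imp_continuous_on[OF G])
  define \<phi> where "\<phi> = (\<lambda>\<theta>. Re (G (rcis R \<theta>)))"
  have \<phi>c: "continuous_on {0..2 * pi} \<phi>"
    unfolding \<phi>_def
    by (intro continuous_intros continuous_on_compose2[OF Gc[of UNIV], where f = "\<lambda>\<theta>. rcis R \<theta>"])
       (auto simp: rcis_def intro!: continuous_intros)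
  \<comment> \<open>At the centre the Poisson kernel is 1, so this is the mean value
    property.\<close>
  have "((\<lambda>\<theta>. Re (G (rcis R \<theta>) * of_real ((R\<^sup>2 - (norm (0::complex))\<^sup>2) / (norm (rcis R \<theta> - 0))\<^sup>2)))
      has_integral Re (2 * of_real pi * G 0)) {0..2 * pi}"
    by (rule has_integral_Re[OF Poisson_formula[OF Gc G]]) (use R in auto)
  then have "integral {0..2 * pi} \<phi> = 2 * pi * Re (G 0)"
    using R by (auto simp: \<phi>_def intro: integral_unique)
  moreover have "Re (G (z - c)) \<le> (R + norm (z - c)) / (R - norm (z - c)) * (integral {0..2 * pi} \<phi> / (2 * pi))"
  proof (rule Re_le_circle_mean[OF Gc G assms(2) \<phi>c])
    show "0 \<le> \<phi> \<theta>" for \<theta> unfolding \<phi>_def G_def using R by (intro assms(3)) simp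
  qed (simp add: \<phi>_def)
  ultimately show ?thesis by (simp add: G_def)
qed

section \<open>Zeros of entire functions and Blaschke factors\<close>

lemma entire_factor_zero:
  assumes "f holomorphic_on UNIV" and "f b \<noteq> 0"
  obtains g n where "g holomorphic_on UNIV" "g a \<noteq> 0" "\<And>z. f z = (z - a) ^ n * g z"
proof (cases "f a = 0")
  case False
  then show ?thesis using that[of f 0] assms by auto
next
  case True
  have "\<not> f constant_on UNIV" using True assms(2) by (metis UNIV_I constant_on_def)
  from holomorphic_factor_zero_nonconstant[OF assms(1) open_UNIV connected_UNIV UNIV_I True this]
  obtain h r n where h: "0 < n" "0 < r" "h holomorphic_on ball a r"
      "\<And>w. w \<in> ball a r \<Longrightarrow> f w = (w - a) ^ n * h w" "\<And>w. w \<in> ball a r \<Longrightarrow> h w \<noteq> 0"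
    by metis
  \<comment> \<open>The local cofactor h at the zero and the quotient f / (z - a)^n agree on the
    punctured ball, so together they give an entire function.\<close>
  define g where "g = (\<lambda>z. if z \<in> ball a r then h z else f z / (z - a) ^ n)"
  have g1: "g z = f z / (z - a) ^ n" if "z \<noteq> a" for z
    using that h(4)[of z] by (auto simp: g_def)
  have "g holomorphic_on (ball a r \<union> (UNIV - {a}))"
  proof (rule holomorphic_on_Un)
    show "g holomorphic_on ball a r"
      by (rule holomorphic_transform[OF h(3)]) (simp add: g_def)
    show "g holomorphic_on UNIV - {a}"
      by (rule holomorphic_transform[of "\<lambda>z. f z / (z - a) ^ n"])
         (auto intro!: holomorphic_intros holomorphic_on_subset[OF assms(1)] simp: g1)
  qed auto
  moreover have "ball a r \<union> (UNIV - {a}) = UNIV" using h(2) by auto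
  ultimately have "g holomorphic_on UNIV" by simp
  moreover have "g a \<noteq> 0" using h by (simp add: g_def)
  moreover have "f z = (z - a) ^ n * g z" for z
    using g1[of z] True h(1) by (cases "z = a") auto
  ultimately show ?thesis using that by blast
qed

text \<open>Both claims follow from |R^2 - cnj b u|^2 - R^2 |u - b|^2 = (R^2 - |u|^2) (R^2 - |b|^2).
  The right side is nonnegative in the disc and zero on the circle.\<close>

lemma Blaschke_factor_norm:
  fixes u b :: complex
  assumes "norm u \<le> R" "norm b \<le> R" "0 < R"
  shows "norm (u - b) \<le> norm ((of_real (R\<^sup>2) - cnj b * u) / of_real R)"
    and "norm u = R \<Longrightarrow> norm (u - b) = norm ((of_real (R\<^sup>2) - cnj b * u) / of_real R)"
proof -
  have key: "(norm (of_real (R\<^sup>2) - cnj b * u))\<^sup>2 - (R * norm (u - b))\<^sup>2 = (R\<^sup>2 - (norm u)\<^sup>2) * (R\<^sup>2 - (norm b)\<^sup>2)"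
  proof -
    have "complex_of_real ((norm (of_real (R\<^sup>2) - cnj b * u))\<^sup>2 - (R * norm (u - b))\<^sup>2)
        = (of_real (R\<^sup>2) - cnj b * u) * cnj (of_real (R\<^sup>2) - cnj b * u) - of_real (R\<^sup>2) * ((u - b) * cnj (u - b))"
      unfolding power_mult_distrib of_real_diff of_real_mult of_real_power
      unfolding complex_norm_square of_real_power[symmetric] ..
    also have "\<dots> = (of_real (R\<^sup>2) - u * cnj u) * (of_real (R\<^sup>2) - b * cnj b)"
      by (simp add: algebra_simps)
    also have "\<dots> = of_real ((R\<^sup>2 - (norm u)\<^sup>2) * (R\<^sup>2 - (norm b)\<^sup>2))"
      unfolding of_real_diff of_real_mult complex_norm_square ..
    finally show ?thesis unfolding of_real_eq_iff .
  qed
  have "0 \<le> (R\<^sup>2 - (norm u)\<^sup>2) * (R\<^sup>2 - (norm b)\<^sup>2)"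
    using assms by (intro mult_nonneg_nonneg) (auto intro: power_mono)
  then have "(R * norm (u - b))\<^sup>2 \<le> (norm (of_real (R\<^sup>2) - cnj b * u))\<^sup>2" using key by linarith
  then have "R * norm (u - b) \<le> norm (of_real (R\<^sup>2) - cnj b * u)" by (rule power2_le_imp_le) simp
  then show "norm (u - b) \<le> norm ((of_real (R\<^sup>2) - cnj b * u) / of_real R)"
    using assms(3) by (simp add: norm_divide field_simps)
  assume "norm u = R"
  then have "(R * norm (u - b))\<^sup>2 = (norm (of_real (R\<^sup>2) - cnj b * u))\<^sup>2" using key by simp
  then have "R * norm (u - b) = norm (of_real (R\<^sup>2) - cnj b * u)"
    using assms(3) by (simp add: power2_eq_iff_nonneg)
  then show "norm (u - b) = norm ((of_real (R\<^sup>2) - cnj b * u) / of_real R)"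
    using assms(3) by (simp add: norm_divide field_simps)
qed

lemma finite_zeros_cball:
  assumes "f holomorphic_on UNIV" and "f b \<noteq> 0"
  shows "finite {z \<in> cball 0 R. f z = 0}"
proof (cases "f constant_on UNIV")
  case True
  then have "f z \<noteq> 0" for z using assms(2) by (metis UNIV_I constant_on_def)
  then show ?thesis by simp
next
  case False
  then show ?thesis using assms(1) by (intro holomorphic_compact_finite_zeros[of f UNIV]) auto
qed

subsection \<open>Growth of entire functions\<close>

text \<open>Induction on the number of distinct zeros in the closed disc. A factor (z - a)^n is
  traded as a whole for the n-th power of a function that has no zero in the disc, is at least as
  large there and has the same modulus on the circle.\<close>

lemma divide_zeros_Blaschke:
  assumes "f holomorphic_on UNIV" and "f b \<noteq> 0" and "0 < R"
    and "\<And>z. norm z = R \<Longrightarrow> f z \<noteq> 0"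
  obtains g where "g holomorphic_on UNIV" "\<And>z. norm z \<le> R \<Longrightarrow> g z \<noteq> 0"
    "\<And>z. norm z \<le> R \<Longrightarrow> norm (f z) \<le> norm (g z)"
    "\<And>z. norm z = R \<Longrightarrow> norm (g z) = norm (f z)"
proof -
  have "\<exists>g. g holomorphic_on UNIV \<and> (\<forall>z. norm z \<le> R \<longrightarrow> g z \<noteq> 0 \<and> norm (f z) \<le> norm (g z))
      \<and> (\<forall>z. norm z = R \<longrightarrow> norm (g z) = norm (f z))"
    using assms(1,2,4)
  proof (induction "card {z \<in> cball 0 R. f z = 0}" arbitrary: f b rule: less_induct)
    case less
    note fin = finite_zeros_cball[OF less.prems(1,2)]
    show ?case
    proof (cases "{z \<in> cball 0 R. f z = 0} = {}")
      case True
      then show ?thesis using less.prems(1) by (intro exI[of _ f]) auto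
    next
      case False
      then obtain a where a: "norm a \<le> R" "f a = 0" by auto
      with less.prems(3)[of a] have aR: "norm a < R" by (cases "norm a = R") auto
      obtain h n where h: "h holomorphic_on UNIV" "h a \<noteq> 0" "\<And>z. f z = (z - a) ^ n * h z"
        using entire_factor_zero[OF less.prems(1,2)] by blast
      \<comment> \<open>B is (z - a) divided by the Blaschke factor of a. If a is not 0, its zero
        R^2 / cnj a lies outside the closed disc, because |a| < R.\<close>
      define B where "B = (\<lambda>z. (of_real (R\<^sup>2) - cnj a * z) / of_real R)"
      define k where "k = (\<lambda>z. B z ^ n * h z)"
      have Bnz: "B z \<noteq> 0" if "norm z \<le> R" for z
      proof (cases "z = a")
        case True
        have "cnj a * a = of_real ((norm a)\<^sup>2)" by (metis complex_norm_square mult.commute of_real_power)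
        moreover have "(norm a)\<^sup>2 < R\<^sup>2" using aR by (intro power_strict_mono) auto
        ultimately show ?thesis using True assms(3) unfolding B_def
          by (auto simp del: of_real_power)
      next
        case False
        moreover have "norm (z - a) \<le> norm (B z)"
          unfolding B_def by (rule Blaschke_factor_norm(1)[OF that a(1) assms(3)])
        ultimately show ?thesis by auto
      qed
      have kh: "k holomorphic_on UNIV"
        unfolding k_def B_def by (intro holomorphic_intros h(1)) (use assms(3) in auto)
      have "\<exists>g. g holomorphic_on UNIV \<and> (\<forall>z. norm z \<le> R \<longrightarrow> g z \<noteq> 0 \<and> norm (k z) \<le> norm (g z))
         \<and> (\<forall>z. norm z = R \<longrightarrow> norm (g z) = norm (k z))"
      proof (rule less.hyps[OF _ kh, of a])
        show "k a \<noteq> 0" using h(2) Bnz a(1) by (auto simp: k_def)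
        show "k z \<noteq> 0" if "norm z = R" for z
          using that less.prems(3)[OF that] h(3)[of z] Bnz[of z] by (auto simp: k_def)
        have "{z \<in> cball 0 R. k z = 0} \<subset> {z \<in> cball 0 R. f z = 0}"
        proof
          show "{z \<in> cball 0 R. k z = 0} \<subseteq> {z \<in> cball 0 R. f z = 0}"
            using Bnz h(3) by (auto simp: k_def)
          have "a \<in> {z \<in> cball 0 R. f z = 0}" "a \<notin> {z \<in> cball 0 R. k z = 0}"
            using a Bnz h(2) by (auto simp: k_def)
          then show "{z \<in> cball 0 R. k z = 0} \<noteq> {z \<in> cball 0 R. f z = 0}" by blast
        qed
        then show "card {z \<in> cball 0 R. k z = 0} < card {z \<in> cball 0 R. f z = 0}"
          using fin by (intro psubset_card_mono)
      qed
      then obtain g where g: "g holomorphic_on UNIV"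
          "\<And>z. norm z \<le> R \<Longrightarrow> g z \<noteq> 0 \<and> norm (k z) \<le> norm (g z)"
          "\<And>z. norm z = R \<Longrightarrow> norm (g z) = norm (k z)" by blast
      have "norm (f z) \<le> norm (k z)" if "norm z \<le> R" for z
        unfolding h(3) k_def norm_mult norm_power B_def
        using that a(1) assms(3) by (intro mult_right_mono power_mono Blaschke_factor_norm) auto
      moreover have "norm (k z) = norm (f z)" if "norm z = R" for z
        unfolding h(3) k_def norm_mult norm_power B_def
        using Blaschke_factor_norm(2)[of z R a] that a(1) assms(3) by simp
      ultimately show ?thesis using g by (intro exI[of _ g]) (metis order_trans)
    qed
  qed
  then show ?thesis using that by blast
qed

section \<open>The characteristic and the maximum modulus\<close>

lemma log_plus_eq: "log_plus x = ln (max 1 x)"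
  by (auto simp: log_plus_def max_def)

lemma log_plus_nonneg: "0 \<le> log_plus x"
  by (simp add: log_plus_def)

lemma proximity_nonneg: "0 \<le> proximity f r"
proof -
  have "0 \<le> integral {0..2 * pi} (\<lambda>\<theta>. log_plus (norm (f (rcis r \<theta>))))"
    by (cases "(\<lambda>\<theta>. log_plus (norm (f (rcis r \<theta>)))) integrable_on {0..2 * pi}")
       (auto intro: Henstock_Kurzweil_Integration.integral_nonneg simp: log_plus_nonneg not_integrable_integral)
  then show ?thesis by (simp add: proximity_def)
qed

text \<open>This bounds the logarithm of the maximum modulus by the proximity function on a larger
  circle. Zeros of f prevent ln |f| from being the real part of a holomorphic function, so f is
  replaced by its zero-free Blaschke modification g. Then ln |g| = Re H, and on the circle Re H = ln
  |f| is at most the positive part of ln |f|.\<close>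

lemma ln_norm_le_proximity:
  assumes "f holomorphic_on UNIV" and "f b \<noteq> 0" and "norm z < R"
    and "\<And>u. norm u = R \<Longrightarrow> f u \<noteq> 0"
  shows "ln (norm (f z)) \<le> (R + norm z) / (R - norm z) * proximity f R"
proof (cases "f z = 0")
  \<comment> \<open>With \<open>ln 0 = 0\<close> only nonnegativity of the right side is at stake
    here.\<close>
  case True
  have "0 \<le> (R + norm z) / (R - norm z)"
    using assms(3) norm_ge_zero[of z] by (intro divide_nonneg_pos) linarith+
  then show ?thesis using True by (simp only: norm_zero ln_0) (intro mult_nonneg_nonneg proximity_nonneg)
next
  case False
  have R: "0 < R" using assms(3) norm_ge_zero[of z] by linarith
  obtain g where g: "g holomorphic_on UNIV" "\<And>z. norm z \<le> R \<Longrightarrow> g z \<noteq> 0"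
      "\<And>z. norm z \<le> R \<Longrightarrow> norm (f z) \<le> norm (g z)"
      "\<And>z. norm z = R \<Longrightarrow> norm (g z) = norm (f z)"
    using divide_zeros_Blaschke[OF assms(1,2) R assms(4)] by blast
  define Z where "Z = {z \<in> cball 0 (R + 1). g z = 0}"
  have "finite Z" unfolding Z_def using finite_zeros_cball[OF g(1), of 0] g(2)[of 0] R by simp
  \<comment> \<open>H must be continuous up to the circle of radius R, so the logarithm is taken on
    a larger open disc that is still free of zeros of g. The entry R + 1 keeps the minimum defined
    when \<open>Z\<close> is empty.\<close>
  define R' where "R' = Min (insert (R + 1) (norm ` Z))"
  have "R < norm u" if "u \<in> Z" for u
    using that g(2)[of u] by (force simp: Z_def)
  then have R': "R < R'" "R' \<le> R + 1"
    unfolding R'_def using \<open>finite Z\<close> by auto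
  have nz: "g u \<noteq> 0" if "u \<in> ball 0 R'" for u
  proof
    assume "g u = 0"
    then have "u \<in> Z" using that R' by (auto simp: Z_def)
    then have "R' \<le> norm u" unfolding R'_def using \<open>finite Z\<close> by (intro Min_le) auto
    then show False using that by simp
  qed
  obtain H where H: "H holomorphic_on ball 0 R'" "\<And>u. u \<in> ball 0 R' \<Longrightarrow> exp (H u) = g u"
    by (rule holomorphic_logarithm_exists[of "ball 0 R'" g 0])
       (use g(1) nz R R' in \<open>auto intro: holomorphic_on_subset\<close>)
  have Re_H: "Re (H u) = ln (norm (g u))" if "norm u \<le> R" for u
  proof -
    have "norm (g u) = exp (Re (H u))" using H(2)[of u] that R' by (metis le_less_trans mem_ball_0 norm_exp_eq_Re)
    then show ?thesis by simp
  qed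
  have fc: "continuous_on {0..2 * pi} (\<lambda>\<theta>. f (rcis R \<theta>))"
    by (intro continuous_on_compose2[OF holomorphic_on_imp_continuous_on[OF assms(1)]])
       (auto simp: rcis_def intro!: continuous_intros)
  have "Re (H z) \<le> (R + norm z) / (R - norm z) *
          (integral {0..2 * pi} (\<lambda>\<theta>. log_plus (norm (f (rcis R \<theta>)))) / (2 * pi))"
  proof (rule Re_le_circle_mean)
    show "H holomorphic_on ball 0 R" using R' by (intro holomorphic_on_subset[OF H(1)]) auto
    show "continuous_on (cball 0 R) H"
      using R' by (intro continuous_on_subset[OF holomorphic_on_imp_continuous_on[OF H(1)]]) auto
    show "continuous_on {0..2 * pi} (\<lambda>\<theta>. log_plus (norm (f (rcis R \<theta>))))"
      unfolding log_plus_eq by (intro continuous_intros fc) auto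
    fix \<theta>
    have "norm (g (rcis R \<theta>)) = norm (f (rcis R \<theta>))" using g(4) R by simp
    then show "Re (H (rcis R \<theta>)) \<le> log_plus (norm (f (rcis R \<theta>)))"
      using Re_H[of "rcis R \<theta>"] R assms(4)[of "rcis R \<theta>"] by (simp add: log_plus_def)
  qed (use assms(3) in \<open>auto simp: log_plus_nonneg\<close>)
  moreover have "ln (norm (f z)) \<le> Re (H z)"
    using Re_H[of z] assms(3) g(3)[of z] False by (simp add: ln_mono)
  ultimately show ?thesis by (simp add: proximity_def)
qed

lemma nevanlinna_T_entire:
  assumes "f holomorphic_on UNIV"
  shows "nevanlinna_T f r = proximity f r"
proof -
  have "\<not> is_pole f z" for z
    using assms by (intro not_is_pole_holomorphic[of UNIV]) auto
  then show ?thesis by (simp add: nevanlinna_T_def pole_counting_def pole_count_def)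
qed

text \<open>Hyper-order below 1 gives T(r) \<le> exp (r^\<rho>) for large r, with some \<rho> < 1.
  Comparing radius s with a radius between 2 s and 3 s carries this over to ln |f|, and a slightly
  larger exponent \<sigma> absorbs the constants.\<close>

lemma ln_norm_growth:
  assumes "f holomorphic_on UNIV" and "hyper_order f < 1"
  obtains \<sigma> where "0 < \<sigma>" "\<sigma> < 1"
    "\<forall>\<^sub>F s in at_top. \<forall>z. norm z \<le> s \<longrightarrow> ln (norm (f z)) \<le> exp (s powr \<sigma>)"
proof (cases "\<exists>b. f b \<noteq> 0")
  case False
  then show ?thesis by (intro that[of "1 / 2"]) auto
next
  case True
  then obtain b where b: "f b \<noteq> 0" by blast
  obtain \<tau> where "hyper_order f < ereal \<tau>" "\<tau> < 1"
    using ereal_dense2[OF assms(2)] by auto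
  \<comment> \<open>\<tau> may be negative or zero; the maximum makes the exponent positive, so that
    r^\<rho> increases with r.\<close>
  define \<rho> where "\<rho> = max \<tau> (1 / 2)"
  define \<sigma> where "\<sigma> = (\<rho> + 1) / 2"
  have \<rho>: "0 < \<rho>" "\<rho> < \<sigma>" "\<sigma> < 1" using \<open>\<tau> < 1\<close> by (auto simp: \<rho>_def \<sigma>_def)
  have "\<forall>\<^sub>F r in at_top. ereal (ln (ln (nevanlinna_T f r)) / ln r) < ereal \<tau>"
    using \<open>hyper_order f < ereal \<tau>\<close> unfolding hyper_order_def by (rule Limsup_lessD)
  then have "\<forall>\<^sub>F r in at_top. proximity f r \<le> exp (r powr \<rho>)"
    using eventually_gt_at_top[of 1]
  proof eventually_elim
    case (elim r)
    let ?T = "proximity f r"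
    have *: "ln (ln ?T) < \<rho> * ln r"
    proof -
      have "0 < ln r" using elim(2) by simp
      have "ln (ln ?T) / ln r < \<tau>" using elim(1) by (simp add: nevanlinna_T_entire[OF assms(1)])
      then have "ln (ln ?T) < \<tau> * ln r" using \<open>0 < ln r\<close> by (simp add: divide_less_eq)
      also have "\<dots> \<le> \<rho> * ln r" using \<open>0 < ln r\<close> by (intro mult_right_mono) (auto simp: \<rho>_def)
      finally show ?thesis .
    qed
    show ?case
    proof (cases "1 < ?T")
      case True
      then have "ln ?T = exp (ln (ln ?T))" by simp
      also have "\<dots> \<le> exp (\<rho> * ln r)" using * by simp
      also have "\<dots> = r powr \<rho>" using elim(2) by (simp add: powr_def)
      finally have "exp (ln ?T) \<le> exp (r powr \<rho>)" by simp
      then show ?thesis using True by simp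
    next
      \<comment> \<open>For T \<le> 1 the bound on \<open>ln (ln T)\<close> carries no information,
        but exp of a nonnegative number is at least 1 anyway.\<close>
      case False
      then show ?thesis by (smt (verit) one_le_exp_iff powr_ge_zero)
    qed
  qed
  then obtain R0 where R0: "\<And>r. R0 \<le> r \<Longrightarrow> proximity f r \<le> exp (r powr \<rho>)"
    unfolding eventually_at_top_linorder by blast
  have "\<forall>\<^sub>F s in at_top. \<forall>z. norm z \<le> s \<longrightarrow> ln (norm (f z)) \<le> 4 * exp ((3 * s) powr \<rho>)"
    using eventually_gt_at_top[of 0] eventually_ge_at_top[of R0]
  proof eventually_elim
    case (elim s)
    have "infinite {2 * s<..<3 * s}" using elim(1) by (simp add: infinite_Ioo)
    moreover have "finite (norm ` {z \<in> cball 0 (3 * s). f z = 0})"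
      using finite_zeros_cball[OF assms(1) b] by blast
    ultimately have "infinite ({2 * s<..<3 * s} - norm ` {z \<in> cball 0 (3 * s). f z = 0})"
      by (rule Diff_infinite_finite[rotated])
    \<comment> \<open>Only finitely many radii carry a zero of f, so R can be chosen with no zero on
      its circle.\<close>
    then obtain R where R: "R \<in> {2 * s<..<3 * s} - norm ` {z \<in> cball 0 (3 * s). f z = 0}"
      using infinite_imp_nonempty by blast
    have nz: "f u \<noteq> 0" if "norm u = R" for u
      using that R by force
    show ?case
    proof (intro allI impI)
      fix z :: complex assume z: "norm z \<le> s"
      have "ln (norm (f z)) \<le> (R + norm z) / (R - norm z) * proximity f R"
        by (rule ln_norm_le_proximity[OF assms(1) b _ nz]) (use z R elim in auto)
      also have "\<dots> \<le> 4 * exp ((3 * s) powr \<rho>)"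
      proof (rule mult_mono)
        have "(R + norm z) \<le> 4 * (R - norm z)" using R z elim by auto
        then show "(R + norm z) / (R - norm z) \<le> 4"
          using R z elim by (auto simp: divide_le_eq)
        have "proximity f R \<le> exp (R powr \<rho>)" using R elim by (intro R0) auto
        also have "\<dots> \<le> exp ((3 * s) powr \<rho>)"
          using R elim \<rho> by (auto intro!: powr_mono2)
        finally show "proximity f R \<le> exp ((3 * s) powr \<rho>)" .
      qed (auto simp: proximity_nonneg)
      finally show "ln (norm (f z)) \<le> 4 * exp ((3 * s) powr \<rho>)" .
    qed
  qed
  moreover have "\<forall>\<^sub>F s in at_top. 4 * exp ((3 * s) powr \<rho>) \<le> exp (s powr \<sigma>)"
    using \<rho> by real_asymp
  ultimately have "\<forall>\<^sub>F s in at_top. \<forall>z. norm z \<le> s \<longrightarrow> ln (norm (f z)) \<le> exp (s powr \<sigma>)"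
    by eventually_elim (meson order_trans)
  with \<rho> show ?thesis by (intro that[of \<sigma>]) auto
qed

text \<open>If \<open>\<phi>\<close> exceeds \<open>C ln |z|\<close> at one point far out, the hypothesis produces points \<open>z\<^sub>n\<close> with
  \<open>|z\<^sub>n| \<le> |z\<^sub>0| + n h\<close> and \<open>\<phi> z\<^sub>n \<ge> c\<^sup>n \<phi> z\<^sub>0\<close>, which is too much growth as \<open>\<sigma> < 1\<close>.\<close>

lemma logarithmic_bound_of_growth:
  fixes \<phi> :: "complex \<Rightarrow> real"
  assumes \<sigma>: "0 < \<sigma>" "\<sigma> < 1"
    and growth: "\<forall>\<^sub>F s in at_top. \<forall>z. norm z \<le> s \<longrightarrow> \<phi> z \<le> exp (s powr \<sigma>)"
    and c: "1 < c" and h: "0 \<le> h" and C: "0 < C"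
    and step: "\<forall>\<^sub>F z in at_infinity. C * ln (norm z) < \<phi> z \<longrightarrow> (\<exists>z'. dist z z' \<le> h \<and> c * \<phi> z \<le> \<phi> z')"
  shows "\<forall>\<^sub>F z in at_infinity. \<phi> z \<le> C * ln (norm z)"
proof -
  obtain r0 where r0: "\<And>z. r0 \<le> norm z \<Longrightarrow> C * ln (norm z) < \<phi> z \<Longrightarrow> \<exists>z'. dist z z' \<le> h \<and> c * \<phi> z \<le> \<phi> z'"
    using step unfolding eventually_at_infinity by blast
  \<comment> \<open>A move by h raises the threshold C ln |z| by at most the factor c, while \<phi>
    gains at least that factor. So \<phi> stays above the threshold along the chain.\<close>
  have "\<forall>\<^sub>F r in at_top. ln (r + h) \<le> c * ln r"
    using c h by real_asymp
  then obtain r1 where r1: "\<And>r. r1 \<le> r \<Longrightarrow> ln (r + h) \<le> c * ln r"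
    unfolding eventually_at_top_linorder by blast
  obtain s0 where s0: "\<And>s z. s0 \<le> s \<Longrightarrow> norm z \<le> s \<Longrightarrow> \<phi> z \<le> exp (s powr \<sigma>)"
    using growth unfolding eventually_at_top_linorder by blast
  define r where "r = max 1 (max r0 (max r1 s0))"
  have r: "1 \<le> r" "r0 \<le> r" "r1 \<le> r" "s0 \<le> r" by (auto simp: r_def)
  define B where "B = exp (r powr \<sigma>)"
  have B: "\<phi> z \<le> B" if "norm z \<le> r" for z
    using s0[OF r(4) that] by (simp add: B_def)
  have "\<forall>\<^sub>F x in at_top. B \<le> C * ln x" using C by real_asymp
  then obtain r2 where r2: "\<And>x. r2 \<le> x \<Longrightarrow> B \<le> C * ln x"
    unfolding eventually_at_top_linorder by blast
  show ?thesis unfolding eventually_at_infinity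
  proof (intro exI[of _ "max r r2"] allI impI, rule ccontr)
    fix z0 :: complex
    assume z0: "max r r2 \<le> norm z0" and "\<not> \<phi> z0 \<le> C * ln (norm z0)"
    then have gt: "C * ln (norm z0) < \<phi> z0" by simp
    then have B0: "B < \<phi> z0" using r2[of "norm z0"] z0 by simp
    have "0 < B" by (simp add: B_def)
    have "\<exists>z. r \<le> norm z \<and> norm z \<le> norm z0 + n * h \<and> C * ln (norm z) < \<phi> z \<and> c ^ n * \<phi> z0 \<le> \<phi> z" for n
    proof (induction n)
      case 0
      then show ?case using z0 gt by (intro exI[of _ z0]) auto
    next
      case (Suc n)
      then obtain z where z: "r \<le> norm z" "norm z \<le> norm z0 + n * h" "C * ln (norm z) < \<phi> z" "c ^ n * \<phi> z0 \<le> \<phi> z"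
        by blast
      obtain z' where z': "dist z z' \<le> h" "c * \<phi> z \<le> \<phi> z'" using r0[of z] z r by auto
      have "1 * \<phi> z0 \<le> c ^ n * \<phi> z0" using c B0 \<open>0 < B\<close> by (intro mult_right_mono) auto
      then have "\<phi> z0 \<le> \<phi> z" using z(4) by simp
      then have "1 * \<phi> z \<le> c * \<phi> z" using c B0 \<open>0 < B\<close> by (intro mult_right_mono) auto
      then have "B < \<phi> z'" using \<open>\<phi> z0 \<le> \<phi> z\<close> B0 z' by simp
      then have rz: "r \<le> norm z'" using B[of z'] by linarith
      have nz': "norm z' \<le> norm z + h"
        using z'(1) norm_triangle_ineq[of z "z' - z"] by (simp add: dist_norm norm_minus_commute)
      have "0 < norm z'" using rz r by linarith
      then have "ln (norm z') \<le> ln (norm z + h)" using nz' by (subst ln_le_cancel_iff) linarith+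
      then have "C * ln (norm z') \<le> C * ln (norm z + h)" using C by simp
      also have "\<dots> \<le> C * (c * ln (norm z))" using r1[of "norm z"] z r C by (intro mult_left_mono) auto
      also have "\<dots> = c * (C * ln (norm z))" by simp
      also have "\<dots> < c * \<phi> z" using z c by simp
      finally have "C * ln (norm z') < \<phi> z'" using z' by simp
      moreover have "c ^ Suc n * \<phi> z0 \<le> c * \<phi> z" using z(4) c by simp
      then have "c ^ Suc n * \<phi> z0 \<le> \<phi> z'" using z' by simp
      ultimately show ?case using rz nz' z(2) by (intro exI[of _ z']) (auto simp: algebra_simps)
    qed
    note chain = this
    have "c ^ n * \<phi> z0 \<le> exp ((norm z0 + n * h) powr \<sigma>)" for n :: nat
    proof -
      obtain z where z: "norm z \<le> norm z0 + n * h" "c ^ n * \<phi> z0 \<le> \<phi> z"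
        using chain[of n] by blast
      have "0 \<le> n * h" using h by simp
      then have "s0 \<le> norm z0 + n * h" using z0 r(4) by simp
      then have "\<phi> z \<le> exp ((norm z0 + n * h) powr \<sigma>)" using z(1) by (rule s0)
      then show ?thesis using z(2) by linarith
    qed
    moreover have "0 < \<phi> z0" using B0 \<open>0 < B\<close> by simp
    \<comment> \<open>c^n is exponential in n, whereas the exponent on the left has order n^\<sigma>
      with \<sigma> < 1. For h = 0 the left side is constant, which is treated separately.\<close>
    have "\<forall>\<^sub>F n in sequentially. exp ((norm z0 + real n * h) powr \<sigma>) < c ^ n * \<phi> z0"
    proof -
      have "0 < norm z0" using z0 r by auto
      show ?thesis
      proof (cases "h = 0")
        case True
        show ?thesis unfolding True using \<open>0 < \<phi> z0\<close> c by simp real_asymp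
      next
        case False
        with h have "0 < h" by simp
        then show ?thesis using \<open>0 < \<phi> z0\<close> c \<sigma> by real_asymp
      qed
    qed
    ultimately have "\<forall>\<^sub>F n in sequentially. False"
      by (auto elim!: eventually_mono simp: not_less[symmetric])
    then show False by simp
  qed
qed

subsection \<open>Rational functions near infinity\<close>

lemma poly_nonzero_at_infinity:
  fixes q :: "complex poly"
  assumes "q \<noteq> 0"
  shows "\<forall>\<^sub>F z in at_infinity. poly q z \<noteq> 0"
proof -
  obtain B where "\<And>z. z \<in> {z. poly q z = 0} \<Longrightarrow> norm z \<le> B"
    using finite_imp_bounded[OF poly_roots_finite[OF assms]] unfolding bounded_iff by blast
  then show ?thesis unfolding eventually_at_infinity
    by (intro exI[of _ "B + 1"]) force
qed

text \<open>No multiplicative constant is needed in the bound: as |z| is eventually large, any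
  constant is absorbed by a higher power.\<close>

definition poly_bounded :: "(complex \<Rightarrow> complex) \<Rightarrow> bool" where
  "poly_bounded f \<longleftrightarrow> (\<exists>k. \<forall>\<^sub>F z in at_infinity. norm (f z) \<le> norm z ^ k)"

lemma norm_ge_at_infinity: "\<forall>\<^sub>F z in at_infinity. c \<le> norm (z :: complex)"
  unfolding eventually_at_infinity by blast

lemma poly_boundedI: 
  assumes "\<forall>\<^sub>F z in at_infinity. norm (f z) \<le> norm z ^ k"
  shows "poly_bounded f"
  using assms by (auto simp: poly_bounded_def)

lemma poly_bounded_const: "poly_bounded (\<lambda>z. c)"
  unfolding poly_bounded_def
  by (rule exI[of _ 1]) (use norm_ge_at_infinity[of "norm c"] in simp)

lemma poly_bounded_ident: "poly_bounded (\<lambda>z. z)"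
  unfolding poly_bounded_def by (rule exI[of _ 1]) simp

lemma poly_bounded_add:
  assumes "poly_bounded f" "poly_bounded g"
  shows "poly_bounded (\<lambda>z. f z + g z)"
proof -
  obtain k l where kl: "\<forall>\<^sub>F z in at_infinity. norm (f z) \<le> norm z ^ k" "\<forall>\<^sub>F z in at_infinity. norm (g z) \<le> norm z ^ l"
    using assms by (auto simp: poly_bounded_def)
  have "\<forall>\<^sub>F z in at_infinity. norm (f z + g z) \<le> norm z ^ Suc (max k l)"
    using kl norm_ge_at_infinity[of 2]
  proof eventually_elim
    case (elim z)
    have "norm z ^ k \<le> norm z ^ max k l" "norm z ^ l \<le> norm z ^ max k l"
      using elim(3) by (auto intro!: power_increasing)
    then have "norm (f z + g z) \<le> 2 * norm z ^ max k l"
      using elim(1,2) norm_triangle_ineq[of "f z" "g z"] by linarith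
    also have "\<dots> \<le> norm z * norm z ^ max k l" using elim(3) by (intro mult_right_mono) auto
    finally show ?case by simp
  qed
  then show ?thesis by (rule poly_boundedI)
qed

lemma poly_bounded_mult:
  assumes "poly_bounded f" "poly_bounded g"
  shows "poly_bounded (\<lambda>z. f z * g z)"
proof -
  obtain k l where kl: "\<forall>\<^sub>F z in at_infinity. norm (f z) \<le> norm z ^ k" "\<forall>\<^sub>F z in at_infinity. norm (g z) \<le> norm z ^ l"
    using assms by (auto simp: poly_bounded_def)
  have "\<forall>\<^sub>F z in at_infinity. norm (f z * g z) \<le> norm z ^ (k + l)"
    using kl by eventually_elim (auto simp: norm_mult power_add intro!: mult_mono)
  then show ?thesis by (rule poly_boundedI)
qed

lemma poly_bounded_poly: "poly_bounded (poly p)"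
proof (induction p)
  case 0
  have "poly 0 = (\<lambda>z :: complex. 0)" by (simp add: fun_eq_iff)
  then show ?case using poly_bounded_const[of 0] by simp
next
  case (pCons a p)
  have "poly_bounded (\<lambda>z. a + z * poly p z)"
    by (intro poly_bounded_add poly_bounded_mult poly_bounded_const poly_bounded_ident pCons)
  moreover have "poly (pCons a p) = (\<lambda>z. a + z * poly p z)" by (simp add: fun_eq_iff)
  ultimately show ?case by simp
qed

text \<open>A nonzero polynomial stays away from 0 near infinity: it is constant or tends to
  infinity. One power of |z| absorbs the constant 1/\<epsilon>.\<close>

lemma poly_bounded_inverse_poly:
  assumes "q \<noteq> 0"
  shows "poly_bounded (\<lambda>z. inverse (poly q z))"
proof -
  obtain c p where q: "q = pCons c p" by (cases q) auto
  have "\<exists>\<epsilon>>0. \<forall>\<^sub>F z in at_infinity. \<epsilon> \<le> norm (poly q z)"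
  proof (cases "p = 0")
    case True
    then show ?thesis using assms q by (intro exI[of _ "norm c"]) auto
  next
    case False
    then show ?thesis using poly_infinity[of p 1 c] unfolding q eventually_at_infinity
      by (intro exI[of _ 1]) auto
  qed
  then obtain \<epsilon> where \<epsilon>: "\<epsilon> > 0" "\<forall>\<^sub>F z in at_infinity. \<epsilon> \<le> norm (poly q z)" by blast
  have "\<forall>\<^sub>F z in at_infinity. norm (inverse (poly q z)) \<le> norm z ^ 1"
    using \<epsilon>(2) norm_ge_at_infinity[of "inverse \<epsilon>"]
  proof eventually_elim
    case (elim z)
    have "inverse (norm (poly q z)) \<le> inverse \<epsilon>" using elim(1) \<epsilon>(1) by (rule le_imp_inverse_le)
    then show ?case using elim(2) by (simp add: norm_inverse)
  qed
  then show ?thesis by (rule poly_boundedI)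
qed

section \<open>Evaluation of rational functions near infinity\<close>

lemma ratfun_cases:
  obtains p q where "r = Fraction_Field.Fract p q" "q \<noteq> 0" "\<forall>\<^sub>F z in at_infinity. ratfun_eval r z = poly p z / poly q z"
proof -
  obtain p q where r: "r = Fraction_Field.Fract p q" "q \<noteq> 0" by (cases r) auto
  have "\<forall>\<^sub>F z in at_infinity. ratfun_eval r z = poly p z / poly q z"
    using poly_nonzero_at_infinity[OF r(2)] by eventually_elim (simp add: r(1) ratfun_eval_Fract del: mult_fract)
  with r show ?thesis by (rule that)
qed

lemma ratfun_eval_0 [simp]: "ratfun_eval 0 z = 0"
  and ratfun_eval_1 [simp]: "ratfun_eval 1 z = 1"
  by (simp_all add: ratfun_eval_def)

text \<open>At poles the default value of \<open>ratfun_eval\<close> can break additivity. The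
  finitely many poles are avoided by going near infinity.\<close>

lemma ratfun_eval_add:
  "\<forall>\<^sub>F z in at_infinity. ratfun_eval (r + s) z = ratfun_eval r z + ratfun_eval s z"
proof -
  obtain p q where r: "r = Fraction_Field.Fract p q" "q \<noteq> 0" by (cases r) auto
  obtain p' q' where s: "s = Fraction_Field.Fract p' q'" "q' \<noteq> 0" by (cases s) auto
  show ?thesis
    using poly_nonzero_at_infinity[OF r(2)] poly_nonzero_at_infinity[OF s(2)]
    by eventually_elim
      (simp only: r(1) s(1) add_fract[OF r(2) s(2)] ratfun_eval_Fract poly_mult poly_add add_frac_eq
        mult_eq_0_iff not_False_eq_True simp_thms)
qed

lemma ratfun_eval_mult:
  "\<forall>\<^sub>F z in at_infinity. ratfun_eval (r * s) z = ratfun_eval r z * ratfun_eval s z"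
proof -
  obtain p q where r: "r = Fraction_Field.Fract p q" "q \<noteq> 0" by (cases r) auto
  obtain p' q' where s: "s = Fraction_Field.Fract p' q'" "q' \<noteq> 0" by (cases s) auto
  show ?thesis
    using poly_nonzero_at_infinity[OF r(2)] poly_nonzero_at_infinity[OF s(2)]
    by eventually_elim
      (simp only: r(1) s(1) mult_fract ratfun_eval_Fract poly_mult times_divide_times_eq
        mult_eq_0_iff not_False_eq_True simp_thms)
qed

lemma poly_bounded_cong:
  assumes "poly_bounded f" "\<forall>\<^sub>F z in at_infinity. g z = f z"
  shows "poly_bounded g"
proof -
  obtain k where "\<forall>\<^sub>F z in at_infinity. norm (f z) \<le> norm z ^ k" using assms(1) by (auto simp: poly_bounded_def)
  then have "\<forall>\<^sub>F z in at_infinity. norm (g z) \<le> norm z ^ k" using assms(2) by eventually_elim simp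
  then show ?thesis by (rule poly_boundedI)
qed

lemma poly_bounded_ratfun_eval: "poly_bounded (ratfun_eval r)"
proof -
  obtain p q where r: "r = Fraction_Field.Fract p q" "q \<noteq> 0" "\<forall>\<^sub>F z in at_infinity. ratfun_eval r z = poly p z / poly q z"
    by (rule ratfun_cases)
  show ?thesis
    by (rule poly_bounded_cong[OF poly_bounded_mult[OF poly_bounded_poly[of p] poly_bounded_inverse_poly[OF r(2)]]])
       (use r(3) in \<open>simp add: divide_inverse\<close>)
qed

text \<open>This is polynomial growth of \<open>inverse r\<close>.\<close>

lemma ratfun_eval_lower_bound:
  assumes "r \<noteq> 0"
  shows "\<exists>k. \<forall>\<^sub>F z in at_infinity. 1 \<le> norm (ratfun_eval r z) * norm z ^ k"
proof -
  obtain k where k: "\<forall>\<^sub>F z in at_infinity. norm (ratfun_eval (inverse r) z) \<le> norm z ^ k"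
    using poly_bounded_ratfun_eval[of "inverse r"] by (auto simp: poly_bounded_def)
  have "\<forall>\<^sub>F z in at_infinity. 1 \<le> norm (ratfun_eval r z) * norm z ^ k"
    using k ratfun_eval_mult[of r "inverse r"]
  proof eventually_elim
    case (elim z)
    have "1 = norm (ratfun_eval r z) * norm (ratfun_eval (inverse r) z)"
      using elim(2) assms by (simp add: norm_mult[symmetric])
    also have "\<dots> \<le> norm (ratfun_eval r z) * norm z ^ k" using elim(1) by (rule mult_left_mono) simp
    finally show ?case .
  qed
  then show ?thesis by blast
qed

section \<open>Polynomials in w with rational coefficients\<close>

lemma eval2_0 [simp]: "eval2 0 z w = 0"
  by (simp add: eval2_def)

lemma eval2_pCons [simp]: "eval2 (pCons c S) z w = ratfun_eval c z + w * eval2 S z w"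
  by (simp add: eval2_def map_poly_pCons)

lemma eval2_1 [simp]: "eval2 1 z w = 1"
  by (simp add: one_pCons)

text \<open>The quantifier over w stands inside \<open>eventually\<close>: the radius depends only
  on the coefficients, so the identity can later be used at w = w(z).\<close>

lemma eval2_add: "\<forall>\<^sub>F z in at_infinity. \<forall>w. eval2 (S + T) z w = eval2 S z w + eval2 T z w"
proof (induction S arbitrary: T)
  case 0
  then show ?case by simp
next
  case (pCons c S)
  obtain d T' where T: "T = pCons d T'" by (cases T) auto
  show ?case using pCons.IH[of T'] ratfun_eval_add[of c d]
    by eventually_elim (simp add: T algebra_simps)
qed

lemma eval2_smult: "\<forall>\<^sub>F z in at_infinity. \<forall>w. eval2 (smult c S) z w = ratfun_eval c z * eval2 S z w"
proof (induction S)
  case 0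
  then show ?case by simp
next
  case (pCons d S)
  show ?case using pCons.IH ratfun_eval_mult[of c d]
    by eventually_elim (simp add: algebra_simps)
qed

lemma eval2_mult: "\<forall>\<^sub>F z in at_infinity. \<forall>w. eval2 (S * T) z w = eval2 S z w * eval2 T z w"
proof (induction S)
  case 0
  then show ?case by simp
next
  case (pCons c S)
  show ?case using pCons.IH eval2_add[of "smult c T" "pCons 0 (S * T)"] eval2_smult[of c T]
    by eventually_elim (simp add: algebra_simps)
qed

text \<open>Induction along Horner's scheme. \<open>max 1 (norm w)\<close> lets the top power
  dominate the lower ones, and each coefficient costs one factor |z| \<ge> 2 to absorb a sum of two
  terms.\<close>

lemma eval2_upper_bound:
  "\<exists>k. \<forall>\<^sub>F z in at_infinity. \<forall>w. norm (eval2 S z w) \<le> norm z ^ k * max 1 (norm w) ^ degree S"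
proof (induction S)
  case 0
  then show ?case by simp
next
  case (pCons c S)
  obtain k where k: "\<forall>\<^sub>F z in at_infinity. \<forall>w. norm (eval2 S z w) \<le> norm z ^ k * max 1 (norm w) ^ degree S"
    using pCons.IH by blast
  obtain l where l: "\<forall>\<^sub>F z in at_infinity. norm (ratfun_eval c z) \<le> norm z ^ l"
    using poly_bounded_ratfun_eval[of c] by (auto simp: poly_bounded_def)
  have "\<forall>\<^sub>F z in at_infinity. \<forall>w. norm (eval2 (pCons c S) z w) \<le> norm z ^ Suc (max k l) * max 1 (norm w) ^ degree (pCons c S)"
    using k l norm_ge_at_infinity[of 2]
  proof eventually_elim
    case (elim z)
    show ?case
    proof
      fix w :: complex
      let ?M = "max 1 (norm w)"
      have p: "norm z ^ k \<le> norm z ^ max k l" "norm z ^ l \<le> norm z ^ max k l"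
        using elim(3) by (auto intro!: power_increasing)
      have "norm (ratfun_eval c z) * 1 \<le> norm z ^ max k l * ?M ^ degree (pCons c S)"
        using elim(2) p(2) by (intro mult_mono one_le_power) auto
      moreover have "norm (w * eval2 S z w) \<le> norm z ^ max k l * ?M ^ degree (pCons c S)"
      proof (cases "S = 0")
        case False
        have "norm (w * eval2 S z w) \<le> ?M * (norm z ^ max k l * ?M ^ degree S)"
          unfolding norm_mult
        proof (rule mult_mono)
          have "norm (eval2 S z w) \<le> norm z ^ k * ?M ^ degree S" using elim(1) by blast
          also have "\<dots> \<le> norm z ^ max k l * ?M ^ degree S" using p(1) by (intro mult_right_mono) auto
          finally show "norm (eval2 S z w) \<le> norm z ^ max k l * ?M ^ degree S" .
        qed auto
        then show ?thesis using False by (simp add: mult_ac)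
      qed simp
      ultimately have "norm (eval2 (pCons c S) z w) \<le> 2 * (norm z ^ max k l * ?M ^ degree (pCons c S))"
        using norm_triangle_ineq[of "ratfun_eval c z" "w * eval2 S z w"] by simp
      also have "\<dots> \<le> norm z * (norm z ^ max k l * ?M ^ degree (pCons c S))"
        using elim(3) by (intro mult_right_mono) auto
      finally show "norm (eval2 (pCons c S) z w) \<le> norm z ^ Suc (max k l) * ?M ^ degree (pCons c S)"
        by (simp add: mult_ac)
    qed
  qed
  then show ?case by blast
qed

text \<open>Once |w| exceeds a large power of |z|, the leading term dominates the others, and the
  leading coefficient is at least a negative power of |z| by
  \<open>ratfun_eval_lower_bound\<close>.\<close>

lemma eval2_lower_bound:
  assumes "S \<noteq> 0"
  shows "\<exists>k. \<forall>\<^sub>F z in at_infinity. \<forall>w. norm z ^ k \<le> norm w \<longrightarrow> norm w ^ degree S \<le> norm (eval2 S z w) * norm z ^ k"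
  using assms
proof (induction S)
  case 0
  then show ?case by simp
next
  case (pCons c S)
  show ?case
  proof (cases "S = 0")
    case True
    then have "c \<noteq> 0" using pCons.prems by simp
    then obtain k where "\<forall>\<^sub>F z in at_infinity. 1 \<le> norm (ratfun_eval c z) * norm z ^ k"
      using ratfun_eval_lower_bound by blast
    then show ?thesis using True by (intro exI[of _ k]) (auto elim: eventually_mono)
  next
    case False
    obtain k where k: "\<forall>\<^sub>F z in at_infinity. \<forall>w. norm z ^ k \<le> norm w \<longrightarrow> norm w ^ degree S \<le> norm (eval2 S z w) * norm z ^ k"
      using pCons.IH False by blast
    obtain l where l: "\<forall>\<^sub>F z in at_infinity. norm (ratfun_eval c z) \<le> norm z ^ l"
      using poly_bounded_ratfun_eval[of c] by (auto simp: poly_bounded_def)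
    have "\<forall>\<^sub>F z in at_infinity. \<forall>w. norm z ^ (k + l + 1) \<le> norm w \<longrightarrow>
        norm w ^ degree (pCons c S) \<le> norm (eval2 (pCons c S) z w) * norm z ^ (k + l + 1)"
      using k l norm_ge_at_infinity[of 2]
    proof eventually_elim
      case (elim z)
      show ?case
      proof (intro allI impI)
        fix w :: complex
        assume w: "norm z ^ (k + l + 1) \<le> norm w"
        have z1: "1 \<le> norm z" using elim(3) by simp
        have "norm z ^ k \<le> norm z ^ (k + l + 1)" using z1 by (intro power_increasing) auto
        then have wk: "norm z ^ k \<le> norm w" using w by linarith
        have w1: "1 \<le> norm w" using w one_le_power[OF z1, of "k + l + 1"] by linarith
        have "norm w * norm w ^ degree S \<le> norm w * (norm (eval2 S z w) * norm z ^ k)"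
          using elim(1) wk by (intro mult_left_mono) auto
        then have 1: "norm w ^ degree (pCons c S) \<le> norm (w * eval2 S z w) * norm z ^ k"
          using False by (simp add: norm_mult mult_ac)
        have "norm z ^ l * norm z ^ (k + 1) \<le> norm w" using w by (simp add: power_add mult_ac)
        also have "norm w = norm w ^ 1" by simp
        also have "\<dots> \<le> norm w ^ degree (pCons c S)" using w1 False by (intro power_increasing) auto
        finally have 2: "norm (ratfun_eval c z) * norm z ^ (k + 1) \<le> norm w ^ degree (pCons c S)"
          using elim(2) by (meson mult_right_mono norm_ge_zero order_trans zero_le_power)
        have "norm (w * eval2 S z w) \<le> norm (eval2 (pCons c S) z w) + norm (ratfun_eval c z)"
          using norm_triangle_ineq4[of "eval2 (pCons c S) z w" "ratfun_eval c z"] by simp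
        then have "norm (w * eval2 S z w) * norm z ^ (k + 1)
            \<le> norm (eval2 (pCons c S) z w) * norm z ^ (k + 1) + norm (ratfun_eval c z) * norm z ^ (k + 1)"
          by (metis distrib_right mult_right_mono norm_ge_zero zero_le_power)
        \<comment> \<open>The factor |z| \<ge> 2 yields twice the wanted quantity; one copy pays for
          the constant term c, by fact 2.\<close>
        moreover have "2 * norm w ^ degree (pCons c S) \<le> norm z * (norm (w * eval2 S z w) * norm z ^ k)"
          using 1 elim(3) by (intro mult_mono) auto
        ultimately have "norm w ^ degree (pCons c S) \<le> norm (eval2 (pCons c S) z w) * norm z ^ (k + 1)"
          using 2 by (simp only: power_add power_one_right mult_ac)
        also have "\<dots> \<le> norm (eval2 (pCons c S) z w) * norm z ^ (k + l + 1)"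
          using z1 by (intro mult_left_mono power_increasing) auto
        finally show "norm w ^ degree (pCons c S) \<le> norm (eval2 (pCons c S) z w) * norm z ^ (k + l + 1)" .
      qed
    qed
    then show ?thesis by blast
  qed
qed

text \<open>If |w| were above the threshold of \<open>eval2_lower_bound\<close>, then |w| \<le>
  |w|^d with d = \<open>degree S\<close> \<ge> 1 would again be bounded by a power of |z|. For n = 0
  this says that solutions of S(z,w) = 0, and approximate ones, grow at most polynomially.\<close>

lemma root_bound:
  assumes "0 < degree S"
  shows "\<exists>k. \<forall>\<^sub>F z in at_infinity. \<forall>w. norm (eval2 S z w) \<le> norm z ^ n \<longrightarrow> norm w \<le> norm z ^ k"
proof -
  obtain k where k: "\<forall>\<^sub>F z in at_infinity. \<forall>w. norm z ^ k \<le> norm w \<longrightarrow> norm w ^ degree S \<le> norm (eval2 S z w) * norm z ^ k"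
    using eval2_lower_bound[of S] assms by fastforce
  have "\<forall>\<^sub>F z in at_infinity. \<forall>w. norm (eval2 S z w) \<le> norm z ^ n \<longrightarrow> norm w \<le> norm z ^ (n + k)"
    using k norm_ge_at_infinity[of 1]
  proof eventually_elim
    case (elim z)
    show ?case
    proof (intro allI impI)
      fix w assume w: "norm (eval2 S z w) \<le> norm z ^ n"
      have mono: "norm z ^ k \<le> norm z ^ (n + k)" using elim(2) by (intro power_increasing) auto
      show "norm w \<le> norm z ^ (n + k)"
      proof (cases "norm z ^ k \<le> norm w")
        case True
        then have "1 \<le> norm w" using one_le_power[OF elim(2), of k] by linarith
        then have "norm w ^ 1 \<le> norm w ^ degree S" using assms by (intro power_increasing) auto
        also have "\<dots> \<le> norm (eval2 S z w) * norm z ^ k" using elim(1) True by blast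
        also have "\<dots> \<le> norm z ^ n * norm z ^ k" using w by (intro mult_right_mono) auto
        finally show ?thesis by (simp add: power_add)
      qed (use mono in linarith)
    qed
  qed
  then show ?thesis by blast
qed

section \<open>Transcendental functions satisfy no algebraic equation\<close>

lemma entire_poly_bounded:
  assumes "f holomorphic_on UNIV" and "poly_bounded f"
  obtains p where "\<And>z. f z = poly p z"
proof -
  obtain k A where "\<And>z. A \<le> norm z \<Longrightarrow> norm (f z) \<le> 1 * norm z ^ k"
    using assms(2) unfolding poly_bounded_def eventually_at_infinity by auto
  from Liouville_polynomial[OF assms(1) this]
  have "f z = poly (\<Sum>i\<le>k. monom ((deriv ^^ i) f 0 / fact i) i) z" for z
    by (simp add: poly_sum poly_monom)
  then show ?thesis using that by blast
qed

lemma transcendental_not_poly_bounded: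
  assumes "w holomorphic_on UNIV" and "transcendental w"
  shows "\<not> poly_bounded w"
proof
  assume "poly_bounded w"
  then obtain p where p: "\<And>z. w z = poly p z" using entire_poly_bounded[OF assms(1)] by blast
  have "\<forall>\<^sub>\<approx>z\<in>UNIV. w z = ratfun_eval (Fraction_Field.Fract p 1) z"
    by (intro always_eventually allI) (simp add: p ratfun_eval_Fract)
  then show False using assms(2) unfolding transcendental_def by blast
qed

text \<open>For positive degree, \<open>root_bound\<close> would make w polynomially bounded, hence
  a polynomial. For degree 0, a nonzero coefficient does not vanish near infinity.\<close>

lemma transcendental_not_root:
  assumes "w holomorphic_on UNIV" and "transcendental w" and "S \<noteq> 0"
  shows "\<not> (\<forall>\<^sub>F z in at_infinity. eval2 S z (w z) = 0)"
proof
  assume *: "\<forall>\<^sub>F z in at_infinity. eval2 S z (w z) = 0"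
  show False
  proof (cases "degree S = 0")
    case True
    then obtain c where S: "S = [:c:]" by (rule degree_eq_zeroE)
    with assms(3) have "c \<noteq> 0" by simp
    then obtain k where "\<forall>\<^sub>F z in at_infinity. 1 \<le> norm (ratfun_eval c z) * norm z ^ k"
      using ratfun_eval_lower_bound by blast
    with * have "\<forall>\<^sub>F z :: complex in at_infinity. False"
      by eventually_elim (simp add: S)
    then show False by (simp add: trivial_limit_at_infinity)
  next
    case False
    then obtain k where "\<forall>\<^sub>F z in at_infinity. \<forall>w. norm (eval2 S z w) \<le> norm z ^ 0 \<longrightarrow> norm w \<le> norm z ^ k"
      using root_bound[of S 0] by blast
    with * have "\<forall>\<^sub>F z in at_infinity. norm (w z) \<le> norm z ^ k"
      by eventually_elim simp
    then have "poly_bounded w" by (rule poly_boundedI)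
    then show False using transcendental_not_poly_bounded[OF assms(1,2)] by blast
  qed
qed

section \<open>The identity theorem on the exterior of a disc\<close>

definition holomorphic_near_infinity :: "(complex \<Rightarrow> complex) \<Rightarrow> bool" where
  "holomorphic_near_infinity f \<longleftrightarrow> (\<exists>\<rho>. f holomorphic_on {z. \<rho> < norm z})"

lemma open_outside_ball: "open {z :: complex. \<rho> < norm z}"
  by (intro open_Collect_less continuous_intros)

lemma connected_outside_ball: "connected {z :: complex. \<rho> < norm z}"
proof -
  have "connected (- cball (0 :: complex) \<rho>)"
    by (rule connected_complement_bounded_convex) auto
  moreover have "- cball (0 :: complex) \<rho> = {z. \<rho> < norm z}" by auto
  ultimately show ?thesis by simp
qed

lemma holomorphic_near_infinity_entire:
  "f holomorphic_on UNIV \<Longrightarrow> holomorphic_near_infinity f"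
  unfolding holomorphic_near_infinity_def by (meson holomorphic_on_subset subset_UNIV)

lemma holomorphic_near_infinity_common:
  assumes "holomorphic_near_infinity f" "holomorphic_near_infinity g"
  obtains \<rho> where "f holomorphic_on {z. \<rho> < norm z}" "g holomorphic_on {z. \<rho> < norm z}" "b \<le> \<rho>"
proof -
  obtain \<rho>1 \<rho>2 where *: "f holomorphic_on {z. \<rho>1 < norm z}" "g holomorphic_on {z. \<rho>2 < norm z}"
    using assms by (auto simp: holomorphic_near_infinity_def)
  have "f holomorphic_on {z. max b (max \<rho>1 \<rho>2) < norm z}"
    by (rule holomorphic_on_subset[OF *(1)]) auto
  moreover have "g holomorphic_on {z. max b (max \<rho>1 \<rho>2) < norm z}"
    by (rule holomorphic_on_subset[OF *(2)]) auto
  ultimately show ?thesis using that[of "max b (max \<rho>1 \<rho>2)"] by simp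
qed

lemma holomorphic_near_infinity_add:
  assumes "holomorphic_near_infinity f" "holomorphic_near_infinity g"
  shows "holomorphic_near_infinity (\<lambda>z. f z + g z)"
  using holomorphic_near_infinity_common[OF assms] holomorphic_on_add
  unfolding holomorphic_near_infinity_def by metis

lemma holomorphic_near_infinity_mult:
  assumes "holomorphic_near_infinity f" "holomorphic_near_infinity g"
  shows "holomorphic_near_infinity (\<lambda>z. f z * g z)"
  using holomorphic_near_infinity_common[OF assms] holomorphic_on_mult
  unfolding holomorphic_near_infinity_def by metis

lemma holomorphic_near_infinity_diff:
  assumes "holomorphic_near_infinity f" "holomorphic_near_infinity g"
  shows "holomorphic_near_infinity (\<lambda>z. f z - g z)"
  using holomorphic_near_infinity_common[OF assms] holomorphic_on_diff
  unfolding holomorphic_near_infinity_def by metis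

lemma holomorphic_near_infinity_ratfun_eval: "holomorphic_near_infinity (ratfun_eval r)"
proof -
  define p where "p = fst (quot_of_fract r)"
  define q where "q = snd (quot_of_fract r)"
  have "q \<noteq> 0" by (simp add: q_def)
  then obtain \<rho> where \<rho>: "\<And>z. \<rho> \<le> norm z \<Longrightarrow> poly q z \<noteq> 0"
    using poly_nonzero_at_infinity unfolding eventually_at_infinity by blast
  have "(\<lambda>z. poly p z / poly q z) holomorphic_on {z. \<rho> < norm z}"
    using \<rho> by (intro holomorphic_intros) auto
  moreover have "ratfun_eval r = (\<lambda>z. poly p z / poly q z)"
    by (simp add: fun_eq_iff ratfun_eval_def p_def q_def)
  ultimately show ?thesis unfolding holomorphic_near_infinity_def by auto
qed

lemma holomorphic_near_infinity_eval2:
  assumes "holomorphic_near_infinity w"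
  shows "holomorphic_near_infinity (\<lambda>z. eval2 S z (w z))"
proof (induction S)
  case 0
  then show ?case by (simp add: holomorphic_near_infinity_entire)
next
  case (pCons c S)
  then show ?case
    by (simp add: holomorphic_near_infinity_add holomorphic_near_infinity_mult assms holomorphic_near_infinity_ratfun_eval)
qed

text \<open>Near a point where G is not 0, D vanishes on a punctured neighbourhood. The exterior of
  a disc is connected, so D vanishes on all of it. This turns identities known only off a sparse
  set, or only after multiplication by G, into identities near infinity.\<close>

lemma vanish_near_infinity:
  assumes "holomorphic_near_infinity G" "holomorphic_near_infinity D"
    and "\<not> (\<forall>\<^sub>F z in at_infinity. G z = 0)"
    and "\<And>z0. b < norm z0 \<Longrightarrow> \<forall>\<^sub>F z in at z0. G z \<noteq> 0 \<longrightarrow> D z = 0"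
  shows "\<forall>\<^sub>F z in at_infinity. D z = 0"
proof -
  obtain \<rho> where \<rho>: "G holomorphic_on {z. \<rho> < norm z}" "D holomorphic_on {z. \<rho> < norm z}" "b \<le> \<rho>"
    using holomorphic_near_infinity_common[OF assms(1,2)] by blast
  have "\<exists>z0. \<rho> < norm z0 \<and> G z0 \<noteq> 0"
  proof (rule ccontr)
    assume "\<not> ?thesis"
    then have "\<forall>\<^sub>F z in at_infinity. G z = 0"
      unfolding eventually_at_infinity by (intro exI[of _ "\<rho> + 1"]) force
    then show False using assms(3) by blast
  qed
  then obtain z0 where z0: "\<rho> < norm z0" "G z0 \<noteq> 0" by blast
  have "isCont G z0"
    using holomorphic_on_imp_continuous_on[OF \<rho>(1)] open_outside_ball z0(1)
    by (auto simp: continuous_on_eq_continuous_at)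
  then have "\<forall>\<^sub>F z in at z0. G z \<noteq> 0"
    using z0(2) tendsto_imp_eventually_ne unfolding isCont_def by blast
  moreover have "\<forall>\<^sub>F z in at z0. G z \<noteq> 0 \<longrightarrow> D z = 0"
    using assms(4)[of z0] z0(1) \<rho>(3) by simp
  moreover have "\<forall>\<^sub>F z in at z0. z \<in> {z. \<rho> < norm z}"
    using z0(1) by (intro eventually_at_in_open' open_outside_ball) simp
  ultimately have "\<forall>\<^sub>F z in at z0. z \<in> {z. \<rho> < norm z \<and> D z = 0}"
    by eventually_elim simp
  then have lim: "z0 islimpt {z. \<rho> < norm z \<and> D z = 0}"
    by (simp add: islimpt_conv_frequently_at eventually_frequently)
  have "D z = 0" if "\<rho> < norm z" for z
    by (rule analytic_continuation[OF \<rho>(2) open_outside_ball connected_outside_ball _ _ lim])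
       (use that z0 in auto)
  then show ?thesis unfolding eventually_at_infinity by (intro exI[of _ "\<rho> + 1"]) force
qed

text \<open>Here g is an element of least degree in the ideal generated by P and Q; division with
  remainder shows that it divides both. The cofactors A and B are kept since the zero-freeness of
  the denominator rests on them.\<close>

lemma reduce_fraction:
  fixes P Q :: "'a :: field poly"
  assumes "Q \<noteq> 0"
  obtains g A B P1 Q1 where "P = g * P1" "Q = g * Q1" "A * P1 + B * Q1 = 1"
proof -
  define I where "I = {f. f \<noteq> 0 \<and> (\<exists>A B. f = A * P + B * Q)}"
  have QI: "Q \<in> I" unfolding I_def using assms by (auto intro: exI[of _ 0] exI[of _ 1])
  define g where "g = arg_min degree (\<lambda>f. f \<in> I)"
  have g: "g \<in> I" "\<And>f. f \<in> I \<Longrightarrow> degree g \<le> degree f"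
    unfolding g_def by (rule arg_min_natI[of _ Q], fact QI) (rule arg_min_nat_le)
  then obtain A B where AB: "g \<noteq> 0" "g = A * P + B * Q" by (auto simp: I_def)
  have dvd: "g dvd C * P + D * Q" for C D
  proof (rule ccontr)
    assume "\<not> g dvd C * P + D * Q"
    let ?m = "(C * P + D * Q) mod g"
    have m: "?m \<noteq> 0" using \<open>\<not> g dvd C * P + D * Q\<close> by (simp add: dvd_eq_mod_eq_0)
    define d where "d = (C * P + D * Q) div g"
    have "?m = C * P + D * Q - d * g" unfolding d_def by (rule minus_div_mult_eq_mod[symmetric])
    also have "d * g = d * (A * P + B * Q)" using AB(2) by simp
    finally have "?m = (C - d * A) * P + (D - d * B) * Q" by (simp add: algebra_simps)
    then have "?m \<in> I" using m unfolding I_def by blast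
    then have "degree g \<le> degree ?m" by (rule g(2))
    moreover have "degree ?m < degree g" using degree_mod_less[OF AB(1)] m by blast
    ultimately show False by simp
  qed
  obtain P1 where P1: "P = g * P1" using dvd[of 1 0] by (auto elim: dvdE)
  obtain Q1 where Q1: "Q = g * Q1" using dvd[of 0 1] by (auto elim: dvdE)
  have "g * (A * P1 + B * Q1) = g * 1" using AB(2) P1 Q1 by (simp add: algebra_simps)
  then have "A * P1 + B * Q1 = 1" using AB(1) by (metis mult_left_cancel)
  then show ?thesis using that P1 Q1 by blast
qed

subsection \<open>The degrees of numerator and denominator\<close>

lemma eventually_at_infinity_imp_at:
  fixes P :: "complex \<Rightarrow> bool"
  assumes "eventually P at_infinity"
  obtains \<rho> where "\<And>z0. \<rho> < norm z0 \<Longrightarrow> eventually P (at z0)"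
proof -
  obtain \<rho> where \<rho>: "\<And>z. \<rho> \<le> norm z \<Longrightarrow> P z" using assms unfolding eventually_at_infinity by blast
  have "eventually P (at z0)" if "\<rho> < norm z0" for z0
  proof -
    have "\<forall>\<^sub>F z in at z0. z \<in> {z. \<rho> < norm z}"
      using that by (intro eventually_at_in_open' open_outside_ball) simp
    then show ?thesis by eventually_elim (simp add: \<rho>)
  qed
  then show ?thesis by (rule that)
qed

lemma exp_nat_mult_ln:
  fixes x :: real
  assumes "0 < x"
  shows "exp (real n * ln x) = x ^ n"
  using assms by (simp only: exp_of_nat_mult exp_ln)

text \<open>Cauchy's estimate on the unit circle about z.\<close>

lemma norm_deriv_le:
  assumes "f holomorphic_on UNIV" and "\<And>u. dist z u \<le> 1 \<Longrightarrow> norm (f u) \<le> M"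
  shows "norm (deriv f z) \<le> M"
proof -
  have "norm ((deriv ^^ 1) f z) \<le> fact 1 * M / 1 ^ 1"
  proof (rule Cauchy_inequality)
    show "f holomorphic_on ball z 1" using assms(1) by (rule holomorphic_on_subset) simp
    show "continuous_on (cball z 1) f"
      using holomorphic_on_imp_continuous_on[OF assms(1)] by (rule continuous_on_subset) simp
    show "norm (f u) \<le> M" if "norm (z - u) = 1" for u using assms(2)[of u] that by (simp add: dist_norm)
  qed auto
  then show ?thesis by simp
qed

text \<open>Let M be the maximum of |w| on the unit disc about z. Where |w| is large, the left side
  of the equation is at most |z|^(m+2) |w| M, while degree at least 3 makes the right side at least
  |w|^3 / |z|^k. So |w|^2 \<le> M |z|^K, and ln |w| grows by a factor 3/2 within distance 1.
  \<open>logarithmic_bound_of_growth\<close> then makes w polynomially bounded.\<close>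

lemma degree_le_2:
  assumes w: "w holomorphic_on UNIV" "transcendental w"
    and \<sigma>: "0 < \<sigma>" "\<sigma> < 1" "\<forall>\<^sub>F s in at_top. \<forall>z. norm z \<le> s \<longrightarrow> ln (norm (w z)) \<le> exp (s powr \<sigma>)"
    and eq: "\<forall>\<^sub>F z in at_infinity. w z * (w (z + 1) - w (z - 1)) + ratfun_eval a z * deriv w z = eval2 S z (w z)"
  shows "degree S \<le> 2"
proof (rule ccontr)
  assume "\<not> degree S \<le> 2"
  then have d: "3 \<le> degree S" by simp
  then have "S \<noteq> 0" by auto
  then obtain k where k: "\<forall>\<^sub>F z in at_infinity. \<forall>w. norm z ^ k \<le> norm w \<longrightarrow> norm w ^ degree S \<le> norm (eval2 S z w) * norm z ^ k"
    using eval2_lower_bound by blast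
  obtain m where m: "\<forall>\<^sub>F z in at_infinity. norm (ratfun_eval a z) \<le> norm z ^ m"
    using poly_bounded_ratfun_eval[of a] by (auto simp: poly_bounded_def)
  define K where "K = k + m + 2"
  have "\<forall>\<^sub>F z in at_infinity. real (4 * K) * ln (norm z) < ln (norm (w z)) \<longrightarrow>
      (\<exists>z'. dist z z' \<le> 1 \<and> (3 / 2) * ln (norm (w z)) \<le> ln (norm (w z')))"
    using k m eq norm_ge_at_infinity[of 2]
  proof eventually_elim
    case (elim z)
    show ?case
    proof
      assume big: "real (4 * K) * ln (norm z) < ln (norm (w z))"
      have lnz: "0 < ln (norm z)" using elim(4) by (intro ln_gt_zero) linarith
      have "0 \<le> real (4 * K) * ln (norm z)" using lnz by simp
      with big have lnw: "0 < ln (norm (w z))" by linarith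
      have w0: "w z \<noteq> 0" using lnw by auto
      then have w1: "1 < norm (w z)" using lnw by simp
      have "norm z ^ (4 * K) = exp (real (4 * K) * ln (norm z))"
        using elim(4) by (intro exp_nat_mult_ln[symmetric]) linarith
      also have "\<dots> \<le> exp (ln (norm (w z)))" using big by simp
      also have "\<dots> = norm (w z)" using w0 by simp
      finally have wz: "norm z ^ (4 * K) \<le> norm (w z)" .
      \<comment> \<open>The disc contains z + 1 and z - 1, and Cauchy's estimate on it controls the
        derivative.\<close>
      have "compact (cball z 1)" "cball z 1 \<noteq> {}" by auto
      moreover have "continuous_on (cball z 1) (\<lambda>u. norm (w u))"
        by (intro continuous_intros continuous_on_subset[OF holomorphic_on_imp_continuous_on[OF w(1)]]) auto
      ultimately obtain z' where z': "z' \<in> cball z 1" "\<And>u. u \<in> cball z 1 \<Longrightarrow> norm (w u) \<le> norm (w z')"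
        using continuous_attains_sup by metis
      define M where "M = norm (w z')"
      have M: "norm (w u) \<le> M" if "dist z u \<le> 1" for u using z'(2) that by (simp add: M_def)
      have wM: "norm (w z) \<le> M" by (rule M) simp
      have dM: "norm (deriv w z) \<le> M" by (rule norm_deriv_le[OF w(1) M])
      have zk: "norm z ^ k \<le> norm (w z)"
      proof (rule order_trans[OF power_increasing wz])
        show "k \<le> 4 * K" by (simp add: K_def)
      qed (use elim(4) in linarith)
      have "norm (w z) ^ 3 \<le> norm (w z) ^ degree S" using w1 d by (intro power_increasing) auto
      also have "\<dots> \<le> norm (eval2 S z (w z)) * norm z ^ k" using elim(1) zk by blast
      also have "\<dots> \<le> (norm (w z) * M * norm z ^ (m + 2)) * norm z ^ k"
      proof (rule mult_right_mono)
        have "norm (w (z + 1) - w (z - 1)) \<le> M + M"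
          using norm_triangle_ineq4[of "w (z + 1)" "w (z - 1)"] M[of "z + 1"] M[of "z - 1"] by (simp add: dist_norm)
        then have 1: "norm (w z * (w (z + 1) - w (z - 1))) \<le> norm (w z) * (2 * M)"
          unfolding norm_mult by (intro mult_left_mono) auto
        have "norm (ratfun_eval a z * deriv w z) \<le> norm z ^ m * M"
          unfolding norm_mult using elim(2) dM by (intro mult_mono) auto
        also have "\<dots> \<le> norm z ^ m * (norm (w z) * M)"
          using w1 wM by (intro mult_left_mono) (auto simp: mult_le_cancel_right1)
        finally have 2: "norm (ratfun_eval a z * deriv w z) \<le> norm z ^ m * (norm (w z) * M)" .
        have "norm (eval2 S z (w z)) \<le> (2 + norm z ^ m) * (norm (w z) * M)"
          unfolding elim(3)[symmetric]
          using norm_triangle_ineq[of "w z * (w (z + 1) - w (z - 1))" "ratfun_eval a z * deriv w z"] 1 2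
          by (simp add: algebra_simps)
        also have "\<dots> \<le> norm z ^ (m + 2) * (norm (w z) * M)"
        proof (rule mult_right_mono)
          have "1 \<le> norm z ^ m" using elim(4) by (intro one_le_power) auto
          then have "2 + norm z ^ m \<le> norm z ^ m * 4" by simp
          also have "\<dots> \<le> norm z ^ m * norm z ^ 2"
            using power_mono[of 2 "norm z" 2] elim(4) by (intro mult_left_mono) auto
          finally show "2 + norm z ^ m \<le> norm z ^ (m + 2)" by (simp only: power_add)
        qed (use wM in \<open>auto simp: M_def\<close>)
        finally show "norm (eval2 S z (w z)) \<le> norm (w z) * M * norm z ^ (m + 2)" by (simp add: mult_ac)
      qed simp
      also have "\<dots> = norm (w z) * (M * norm z ^ K)" by (simp add: K_def power_add power2_eq_square mult_ac)
      finally have "norm (w z) * norm (w z) ^ 2 \<le> norm (w z) * (M * norm z ^ K)"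
        by (simp add: power3_eq_cube power2_eq_square mult_ac)
      then have "norm (w z) ^ 2 \<le> M * norm z ^ K" using w0 by simp
      then have "ln (norm (w z) ^ 2) \<le> ln (M * norm z ^ K)" using w0 by (intro ln_mono) auto
      also have "\<dots> = ln M + real K * ln (norm z)"
      proof -
        have "0 < M" "0 < norm z" using w1 wM elim(4) by linarith+
        then show ?thesis by (simp add: ln_mult ln_realpow)
      qed
      finally have "2 * ln (norm (w z)) \<le> ln M + real K * ln (norm z)"
        using w0 by (simp add: ln_realpow)
      \<comment> \<open>The threshold 4 K gives K ln |z| < ln |w| / 4, so the factor left is 2 - 1/4
        > 3/2.\<close>
      then have "(3 / 2) * ln (norm (w z)) \<le> ln (norm (w z'))" using big lnw by (simp add: M_def)
      then show "\<exists>z'. dist z z' \<le> 1 \<and> (3 / 2) * ln (norm (w z)) \<le> ln (norm (w z'))"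
        using z'(1) by auto
    qed
  qed
  then have "\<forall>\<^sub>F z in at_infinity. ln (norm (w z)) \<le> real (4 * K) * ln (norm z)"
    by (intro logarithmic_bound_of_growth[OF \<sigma>, of "3 / 2" 1]) (auto simp: K_def)
  then have "\<forall>\<^sub>F z in at_infinity. norm (w z) \<le> norm z ^ (4 * K)"
    using norm_ge_at_infinity[of 2]
  proof eventually_elim
    case (elim z)
    show ?case
    proof (cases "w z = 0")
      case False
      then have "norm (w z) = exp (ln (norm (w z)))" by simp
      also have "\<dots> \<le> exp (real (4 * K) * ln (norm z))" using elim(1) by simp
      also have "\<dots> = norm z ^ (4 * K)"
        using elim(2) by (intro exp_nat_mult_ln) linarith
      finally show ?thesis .
    qed simp
  qed
  then show False using transcendental_not_poly_bounded[OF w] poly_boundedI by blast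
qed

text \<open>Multiplying by the denominators of all coefficients gives an entire function V, to which
  factorization by zeros applies. Equality is claimed near infinity only, away from the poles of the
  coefficients.\<close>

lemma clear_denominators:
  assumes "w holomorphic_on UNIV"
  shows "\<exists>D V. D \<noteq> 0 \<and> V holomorphic_on UNIV \<and> (\<forall>\<^sub>F z in at_infinity. poly D z * eval2 S z (w z) = V z)"
proof (induction S)
  case 0
  show ?case by (intro exI[of _ 1] exI[of _ "\<lambda>_. 0"]) auto
next
  case (pCons c S)
  then obtain D V where DV: "D \<noteq> 0" "V holomorphic_on UNIV" "\<forall>\<^sub>F z in at_infinity. poly D z * eval2 S z (w z) = V z"
    by blast
  obtain p q where pq: "q \<noteq> 0" "\<forall>\<^sub>F z in at_infinity. ratfun_eval c z = poly p z / poly q z"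
    by (rule ratfun_cases)
  have "\<forall>\<^sub>F z in at_infinity. poly (D * q) z * eval2 (pCons c S) z (w z) = poly D z * poly p z + poly q z * w z * V z"
    using DV(3) pq(2) poly_nonzero_at_infinity[OF pq(1)]
  proof eventually_elim
    case (elim z)
    have "poly (D * q) z * eval2 (pCons c S) z (w z)
        = poly D z * (poly q z * ratfun_eval c z) + poly q z * w z * (poly D z * eval2 S z (w z))"
      by (simp add: algebra_simps)
    also have "poly q z * ratfun_eval c z = poly p z" using elim by simp
    finally show ?case by (simp only: elim(1))
  qed
  moreover have "(\<lambda>z. poly D z * poly p z + poly q z * w z * V z) holomorphic_on UNIV"
    by (intro holomorphic_intros DV assms)
  ultimately show ?case using DV(1) pq(1)
    by (intro exI[of _ "D * q"] exI[of _ "\<lambda>z. poly D z * poly p z + poly q z * w z * V z"]) simp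
qed

text \<open>The zeros are divided out one point at a time; the remaining zero-free entire function
  has a holomorphic logarithm.\<close>

lemma entire_finite_zeros_factorization:
  assumes "f holomorphic_on UNIV" and "finite {z. f z = 0}"
  obtains p g where "p \<noteq> 0" "g holomorphic_on UNIV" "\<And>z. f z = poly p z * exp (g z)"
proof -
  have "\<exists>p g. p \<noteq> 0 \<and> g holomorphic_on UNIV \<and> (\<forall>z. f z = poly p z * exp (g z))"
    using assms
  proof (induction "card {z. f z = 0}" arbitrary: f rule: less_induct)
    case less
    show ?case
    proof (cases "\<exists>a. f a = 0")
      case False
      obtain g where "g holomorphic_on UNIV" "\<And>z. exp (g z) = f z"
        by (rule holomorphic_logarithm_exists[of UNIV f 0]) (use less.prems False in auto)
      then show ?thesis by (intro exI[of _ 1] exI[of _ g]) auto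
    next
      case True
      then obtain a where a: "f a = 0" by blast
      have "{z. f z = 0} \<noteq> UNIV" using less.prems(2) infinite_UNIV_char_0[where 'a = complex] by metis
      then obtain b where "f b \<noteq> 0" by blast
      then obtain h n where h: "h holomorphic_on UNIV" "h a \<noteq> 0" "\<And>z. f z = (z - a) ^ n * h z"
        using entire_factor_zero[OF less.prems(1)] by blast
      have sub: "{z. h z = 0} \<subset> {z. f z = 0}" using a h(2,3) by auto
      then have "finite {z. h z = 0}" using less.prems(2) finite_subset by blast
      moreover have "card {z. h z = 0} < card {z. f z = 0}"
        using sub less.prems(2) by (rule psubset_card_mono[rotated])
      ultimately obtain p g where pg: "p \<noteq> 0" "g holomorphic_on UNIV" "\<And>z. h z = poly p z * exp (g z)"
        using less.hyps[of h] h(1) by blast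
      show ?thesis
        using pg h(3) by (intro exI[of _ "[:- a, 1:] ^ n * p"] exI[of _ g]) (simp add: poly_power mult_ac)
    qed
  qed
  then show ?thesis using that by blast
qed

text \<open>After clearing denominators all zeros lie in a bounded disc, so there are finitely many.
  Then r is the polynomial of zeros divided by the cleared denominator.\<close>

lemma eval2_eq_ratfun_times_exp:
  assumes w: "w holomorphic_on UNIV" and nz: "\<forall>\<^sub>F z in at_infinity. eval2 S z (w z) \<noteq> 0"
  obtains r g where "g holomorphic_on UNIV" "\<forall>\<^sub>F z in at_infinity. eval2 S z (w z) = ratfun_eval r z * exp (g z)"
    "r \<noteq> 0"
proof -
  obtain D V where DV: "D \<noteq> 0" "V holomorphic_on UNIV" "\<forall>\<^sub>F z in at_infinity. poly D z * eval2 S z (w z) = V z"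
    using clear_denominators[OF w] by blast
  have "\<forall>\<^sub>F z in at_infinity. V z \<noteq> 0"
    using DV(3) nz poly_nonzero_at_infinity[OF DV(1)] by eventually_elim (metis mult_eq_0_iff)
  then obtain B where B: "\<And>z. B \<le> norm z \<Longrightarrow> V z \<noteq> 0" unfolding eventually_at_infinity by blast
  then have "V (of_real (max B 0)) \<noteq> 0" by (intro B) simp
  moreover have "{z. V z = 0} \<subseteq> {z \<in> cball 0 B. V z = 0}" using B by force
  ultimately have "finite {z. V z = 0}" using finite_zeros_cball[OF DV(2)] finite_subset by blast
  then obtain p g where pg: "p \<noteq> 0" "g holomorphic_on UNIV" "\<And>z. V z = poly p z * exp (g z)"
    using entire_finite_zeros_factorization[OF DV(2)] by blast
  have "\<forall>\<^sub>F z in at_infinity. eval2 S z (w z) = ratfun_eval (Fraction_Field.Fract p D) z * exp (g z)"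
    using DV(3) poly_nonzero_at_infinity[OF DV(1)]
  proof eventually_elim
    case (elim z)
    have "poly D z * eval2 S z (w z) = poly p z * exp (g z)" using elim(1) pg(3) by simp
    then show ?case using elim(2) by (simp add: ratfun_eval_Fract field_simps)
  qed
  moreover have "Fraction_Field.Fract p D \<noteq> 0"
    using pg(1) DV(1) by (simp add: Zero_fract_def eq_fract)
  ultimately show ?thesis using that pg(2) by blast
qed

text \<open>Subtracting r from the constant coefficient leaves the degree positive, so w would be a
  root of a nonzero polynomial.\<close>

lemma not_root_ratfun:
  assumes w: "w holomorphic_on UNIV" "transcendental w" and S: "0 < degree S"
  shows "\<not> (\<forall>\<^sub>F z in at_infinity. eval2 S z (w z) = ratfun_eval r z)"
proof
  assume *: "\<forall>\<^sub>F z in at_infinity. eval2 S z (w z) = ratfun_eval r z"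
  have "\<forall>\<^sub>F z in at_infinity. eval2 (S + [:- r:]) z (w z) = 0"
    using * eval2_add[of S "[:- r:]"] ratfun_eval_add[of r "- r"]
    by eventually_elim simp
  moreover have "degree (S + [:- r:]) = degree S" using S by (intro degree_add_eq_left) simp
  then have "S + [:- r:] \<noteq> 0" using S by auto
  ultimately show False using transcendental_not_root[OF w] by blast
qed

text \<open>A bound of Borel-Caratheodory type: with A an upper bound for Re g on the circle of
  radius 2 s, Harnack's inequality for A - Re g at |z| \<le> s, with factor at most 3, gives - Re g
  \<le> 2 A + 3 |g(0)|.\<close>

lemma neg_Re_growth:
  assumes g: "g holomorphic_on UNIV"
    and \<sigma>: "0 < \<sigma>" "\<sigma> < 1" and q: "0 < q"
    and bound: "\<forall>\<^sub>F s in at_top. \<forall>z. norm z = s \<longrightarrow> Re (g z) \<le> K * ln s + q * exp (s powr \<sigma>)"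
  obtains \<tau> where "0 < \<tau>" "\<tau> < 1" "\<forall>\<^sub>F s in at_top. \<forall>z. norm z \<le> s \<longrightarrow> - Re (g z) \<le> exp (s powr \<tau>)"
proof -
  define \<tau> where "\<tau> = (\<sigma> + 1) / 2"
  have \<tau>: "0 < \<tau>" "\<sigma> < \<tau>" "\<tau> < 1" using \<sigma> by (auto simp: \<tau>_def)
  \<comment> \<open>Unlike K, L is positive, which makes the bound A below nonnegative.\<close>
  define L where "L = max K 1"
  define c where "c = norm (g 0) + 1"
  have L: "0 < L" "K \<le> L" by (auto simp: L_def)
  have c: "0 < c" by (simp add: c_def add_nonneg_pos)
  obtain s0 where s0: "\<And>z. s0 \<le> norm z \<Longrightarrow> Re (g z) \<le> K * ln (norm z) + q * exp (norm z powr \<sigma>)"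
    using bound unfolding eventually_at_top_linorder by blast
  have "\<forall>\<^sub>F s in at_top. \<forall>z. norm z \<le> s \<longrightarrow> - Re (g z) \<le> 2 * (L * ln (2 * s) + q * exp ((2 * s) powr \<sigma>)) + 3 * c"
    using eventually_ge_at_top[of 1] eventually_ge_at_top[of s0]
  proof eventually_elim
    case (elim s)
    define A where "A = L * ln (2 * s) + q * exp ((2 * s) powr \<sigma>)"
    have A0: "0 \<le> A" unfolding A_def using L q elim by (intro add_nonneg_nonneg mult_nonneg_nonneg ln_ge_zero) auto
    show ?case
    proof (intro allI impI)
      fix z :: complex assume z: "norm z \<le> s"
      have "Re (of_real A - g z) \<le> (2 * s + norm (z - 0)) / (2 * s - norm (z - 0)) * Re (of_real A - g 0)"
      proof (rule Harnack_upper)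
        show "(\<lambda>u. of_real A - g u) holomorphic_on UNIV" by (intro holomorphic_intros g)
        show "norm (z - 0) < 2 * s" using z elim by simp
        fix u :: complex assume "norm (u - 0) = 2 * s"
        then have u: "norm u = 2 * s" by simp
        have "Re (g u) \<le> K * ln (2 * s) + q * exp ((2 * s) powr \<sigma>)"
          using s0[of u] u elim by simp
        also have "\<dots> \<le> A" unfolding A_def using L elim by (intro add_right_mono mult_right_mono ln_ge_zero) auto
        finally show "0 \<le> Re (of_real A - g u)" by simp
      qed
      also have "\<dots> \<le> 3 * (A + norm (g 0))"
      proof (rule order_trans)
        have "Re (of_real A - g 0) \<le> A + norm (g 0)" using abs_Re_le_cmod[of "g 0"] by simp
        then show "(2 * s + norm (z - 0)) / (2 * s - norm (z - 0)) * Re (of_real A - g 0)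
            \<le> (2 * s + norm (z - 0)) / (2 * s - norm (z - 0)) * (A + norm (g 0))"
          using z elim by (intro mult_left_mono divide_nonneg_nonneg) auto
        have "2 * s + norm z \<le> 3 * (2 * s - norm z)" using z elim by simp
        then show "(2 * s + norm (z - 0)) / (2 * s - norm (z - 0)) * (A + norm (g 0)) \<le> 3 * (A + norm (g 0))"
          using z elim A0 by (intro mult_right_mono) (auto simp: divide_le_eq)
      qed
      finally show "- Re (g z) \<le> 2 * (L * ln (2 * s) + q * exp ((2 * s) powr \<sigma>)) + 3 * c"
        unfolding A_def[symmetric] by (simp add: c_def)
    qed
  qed
  moreover have "\<forall>\<^sub>F s in at_top. 2 * (L * ln (2 * s) + q * exp ((2 * s) powr \<sigma>)) + 3 * c \<le> exp (s powr \<tau>)"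
    using L(1) q c \<sigma> \<tau> by real_asymp
  ultimately have "\<forall>\<^sub>F s in at_top. \<forall>z. norm z \<le> s \<longrightarrow> - Re (g z) \<le> exp (s powr \<tau>)"
    by eventually_elim (meson order_trans)
  with \<tau> show ?thesis by (intro that[of \<tau>]) auto
qed

text \<open>Take logarithms in |exp g| = |S(z,w)| / |r|, with the polynomial upper bound for S and
  the lower bound for r.\<close>

lemma Re_log_growth:
  assumes \<sigma>: "\<forall>\<^sub>F s in at_top. \<forall>z. norm z \<le> s \<longrightarrow> ln (norm (w z)) \<le> exp (s powr \<sigma>)"
    and r: "r \<noteq> 0"
    and eq: "\<forall>\<^sub>F z in at_infinity. eval2 S z (w z) = ratfun_eval r z * exp (g z)"
  shows "\<exists>K. \<forall>\<^sub>F s in at_top. \<forall>z. norm z = s \<longrightarrow> Re (g z) \<le> K * ln s + real (degree S) * exp (s powr \<sigma>)"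
proof -
  obtain k where k: "\<forall>\<^sub>F z in at_infinity. \<forall>w. norm (eval2 S z w) \<le> norm z ^ k * max 1 (norm w) ^ degree S"
    using eval2_upper_bound by blast
  obtain l where l: "\<forall>\<^sub>F z in at_infinity. 1 \<le> norm (ratfun_eval r z) * norm z ^ l"
    using ratfun_eval_lower_bound[OF r] by blast
  obtain s0 where s0: "\<And>s z. s0 \<le> s \<Longrightarrow> norm z \<le> s \<Longrightarrow> ln (norm (w z)) \<le> exp (s powr \<sigma>)"
    using \<sigma> unfolding eventually_at_top_linorder by blast
  have "\<forall>\<^sub>F z in at_infinity. Re (g z) \<le> real (k + l) * ln (norm z) + real (degree S) * exp (norm z powr \<sigma>)"
    using k l eq norm_ge_at_infinity[of 1] norm_ge_at_infinity[of s0]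
  proof eventually_elim
    case (elim z)
    define W where "W = max 1 (norm (w z))"
    have W: "0 < W" "ln W \<le> exp (norm z powr \<sigma>)"
      using s0[OF elim(5), of z] by (auto simp: W_def max_def)
    have "exp (Re (g z)) = 1 * norm (exp (g z))" by simp
    also have "\<dots> \<le> norm (ratfun_eval r z) * norm z ^ l * norm (exp (g z))"
      using elim(2) by (intro mult_right_mono) auto
    also have "\<dots> = norm (eval2 S z (w z)) * norm z ^ l"
      unfolding elim(3) by (simp add: norm_mult)
    also have "\<dots> \<le> norm z ^ k * W ^ degree S * norm z ^ l"
      using elim(1) by (intro mult_right_mono) (auto simp: W_def)
    also have "\<dots> = norm z ^ (k + l) * W ^ degree S" by (simp add: power_add)
    finally have "ln (exp (Re (g z))) \<le> ln (norm z ^ (k + l) * W ^ degree S)"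
      by (intro ln_mono) auto
    also have "\<dots> = real (k + l) * ln (norm z) + real (degree S) * ln W"
      using W elim(4) by (subst ln_mult) (auto simp: ln_realpow)
    also have "\<dots> \<le> real (k + l) * ln (norm z) + real (degree S) * exp (norm z powr \<sigma>)"
      using W by (intro add_left_mono mult_left_mono) auto
    finally show ?case by simp
  qed
  then show ?thesis unfolding eventually_at_infinity eventually_at_top_linorder by blast
qed

text \<open>Put x = - Re g(z). The function 3 x / 2 + Re g is nonnegative on the circle of radius 3
  about z and equals x / 2 at z. Harnack's factor at distance 1 is at most 2, so its value at
  \<zeta> is at most x.\<close>

lemma Harnack_dichotomy:
  assumes g: "g holomorphic_on UNIV"
    and no: "\<And>u. dist z u \<le> 3 \<Longrightarrow> - Re (g u) \<le> 3 / 2 * (- Re (g z))"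
    and \<zeta>: "dist z \<zeta> \<le> 1"
  shows "- Re (g z) / 2 \<le> - Re (g \<zeta>)"
proof -
  define A where "A = 3 / 2 * (- Re (g z))"
  have d: "norm (\<zeta> - z) \<le> 1" using \<zeta> by (simp add: dist_norm norm_minus_commute)
  have "Re (of_real A + g \<zeta>) \<le> (3 + norm (\<zeta> - z)) / (3 - norm (\<zeta> - z)) * Re (of_real A + g z)"
  proof (rule Harnack_upper)
    show "(\<lambda>u. of_real A + g u) holomorphic_on UNIV" by (intro holomorphic_intros g)
    show "norm (\<zeta> - z) < 3" using d by simp
    fix u assume "norm (u - z) = 3"
    then have "- Re (g u) \<le> A" unfolding A_def by (intro no) (simp add: dist_norm norm_minus_commute)
    then show "0 \<le> Re (of_real A + g u)" by simp
  qed
  also have "\<dots> \<le> 2 * Re (of_real A + g z)"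
  proof (rule mult_right_mono)
    show "(3 + norm (\<zeta> - z)) / (3 - norm (\<zeta> - z)) \<le> 2"
      using d by (simp add: divide_le_eq)
    have "- Re (g z) \<le> A" unfolding A_def by (rule no) simp
    then show "0 \<le> Re (of_real A + g z)" by simp
  qed
  finally show ?thesis by (simp add: A_def field_simps)
qed

lemma denominator_constant:
  assumes w: "w holomorphic_on UNIV" "transcendental w"
    and \<sigma>: "0 < \<sigma>" "\<sigma> < 1" "\<forall>\<^sub>F s in at_top. \<forall>z. norm z \<le> s \<longrightarrow> ln (norm (w z)) \<le> exp (s powr \<sigma>)"
    and eq: "\<forall>\<^sub>F z in at_infinity. (w z * (w (z + 1) - w (z - 1)) + ratfun_eval a z * deriv w z) * eval2 Q z (w z)
               = eval2 P z (w z)"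
    and bezout: "A * P + B * Q = 1"
  shows "degree Q = 0"
proof (rule ccontr)
  assume "degree Q \<noteq> 0"
  then have dQ: "0 < degree Q" by simp
  define F where "F = (\<lambda>z. w z * (w (z + 1) - w (z - 1)) + ratfun_eval a z * deriv w z)"
  \<comment> \<open>The Bezout identity evaluated at w(z), with P(z,w) replaced by F Q(z,w). It
    shows that Q(z,w(z)) has no zeros near infinity, and that it cannot be tiny where w and F are
    polynomially bounded.\<close>
  have unit: "\<forall>\<^sub>F z in at_infinity. eval2 Q z (w z) * (eval2 A z (w z) * F z + eval2 B z (w z)) = 1"
    using eq eval2_mult[of A P] eval2_mult[of B Q] eval2_add[of "A * P" "B * Q"]
  proof eventually_elim
    case (elim z)
    have "eval2 Q z (w z) * (eval2 A z (w z) * F z + eval2 B z (w z))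
        = eval2 A z (w z) * (F z * eval2 Q z (w z)) + eval2 B z (w z) * eval2 Q z (w z)"
      by (simp add: algebra_simps)
    also have "F z * eval2 Q z (w z) = eval2 P z (w z)" using elim(1) by (simp add: F_def)
    also have "eval2 A z (w z) * eval2 P z (w z) + eval2 B z (w z) * eval2 Q z (w z) = eval2 (A * P + B * Q) z (w z)"
      by (simp only: elim(2-4))
    finally show ?case by (simp only: bezout eval2_1)
  qed
  then have "\<forall>\<^sub>F z in at_infinity. eval2 Q z (w z) \<noteq> 0"
    by eventually_elim (metis mult_zero_left zero_neq_one)
  then obtain r g where g: "g holomorphic_on UNIV" and
      Qeq: "\<forall>\<^sub>F z in at_infinity. eval2 Q z (w z) = ratfun_eval r z * exp (g z)" and r: "r \<noteq> 0"
    by (rule eval2_eq_ratfun_times_exp[OF w(1)])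
  obtain K where K: "\<forall>\<^sub>F s in at_top. \<forall>z. norm z = s \<longrightarrow> Re (g z) \<le> K * ln s + real (degree Q) * exp (s powr \<sigma>)"
    using Re_log_growth[OF \<sigma>(3) r Qeq] by blast
  have "0 < real (degree Q)" using dQ by simp
  \<comment> \<open>The a priori growth bound on - Re g that
    \<open>logarithmic_bound_of_growth\<close> requires.\<close>
  then obtain \<tau> where \<tau>: "0 < \<tau>" "\<tau> < 1" "\<forall>\<^sub>F s in at_top. \<forall>z. norm z \<le> s \<longrightarrow> - Re (g z) \<le> exp (s powr \<tau>)"
    by (rule neg_Re_growth[OF g \<sigma>(1,2) _ K])
  obtain k where k: "\<forall>\<^sub>F z in at_infinity. \<forall>w. norm (eval2 Q z w) \<le> norm z ^ 0 \<longrightarrow> norm w \<le> norm z ^ k"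
    using root_bound[OF dQ] by blast
  obtain l where l: "\<forall>\<^sub>F z in at_infinity. norm (ratfun_eval r z) \<le> norm z ^ l"
    using poly_bounded_ratfun_eval[of r] by (auto simp: poly_bounded_def)
  obtain m where m: "\<forall>\<^sub>F z in at_infinity. norm (ratfun_eval a z) \<le> norm z ^ m"
    using poly_bounded_ratfun_eval[of a] by (auto simp: poly_bounded_def)
  obtain i where i: "\<forall>\<^sub>F z in at_infinity. \<forall>w. norm (eval2 A z w) \<le> norm z ^ i * max 1 (norm w) ^ degree A"
    using eval2_upper_bound by blast
  obtain j where j: "\<forall>\<^sub>F z in at_infinity. \<forall>w. norm (eval2 B z w) \<le> norm z ^ j * max 1 (norm w) ^ degree B"
    using eval2_upper_bound by blast
  \<comment> \<open>With |w| \<le> |z|^(2k) on the unit disc about z, both A F and B are bounded by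
    a small multiple of |z|^e. The 3 extra powers in N absorb constants, as |z|^3 \<ge> 8.\<close>
  define e where "e = i + 2 * k * degree A + 4 * k + m + j + 2 * k * degree B"
  define N where "N = e + 3"
  \<comment> \<open>|r| costs the power 2 l on the disc and Q(z,w) is to be at most |z|^(-N). The
    outer factor 2 makes up for the half lost in \<open>Harnack_dichotomy\<close>.\<close>
  define C where "C = real (2 * (2 * l + N))"
  have "\<forall>\<^sub>F z in at_infinity. (\<forall>w. norm (eval2 Q z w) \<le> 1 \<longrightarrow> norm w \<le> norm z ^ k) \<and>
      norm (ratfun_eval r z) \<le> norm z ^ l \<and> eval2 Q z (w z) = ratfun_eval r z * exp (g z)"
    using k l Qeq by eventually_elim simp
  then obtain \<rho> where \<rho>: "\<And>z u. \<rho> \<le> norm z \<Longrightarrow> norm (eval2 Q z u) \<le> 1 \<Longrightarrow> norm u \<le> norm z ^ k"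
      "\<And>z. \<rho> \<le> norm z \<Longrightarrow> norm (ratfun_eval r z) \<le> norm z ^ l"
      "\<And>z. \<rho> \<le> norm z \<Longrightarrow> eval2 Q z (w z) = ratfun_eval r z * exp (g z)"
    unfolding eventually_at_infinity by blast
  have "\<forall>\<^sub>F z in at_infinity. C * ln (norm z) < - Re (g z) \<longrightarrow>
      (\<exists>z'. dist z z' \<le> 3 \<and> 3 / 2 * (- Re (g z)) \<le> - Re (g z'))"
    using m i j unit norm_ge_at_infinity[of "\<rho> + 1"] norm_ge_at_infinity[of 2]
  proof eventually_elim
    case (elim z)
    show ?case
    proof (rule impI, rule ccontr)
      assume big: "C * ln (norm z) < - Re (g z)"
      assume "\<not> (\<exists>z'. dist z z' \<le> 3 \<and> 3 / 2 * (- Re (g z)) \<le> - Re (g z'))"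
      then have half: "- Re (g z) / 2 \<le> - Re (g \<zeta>)" if "dist z \<zeta> \<le> 1" for \<zeta>
        using Harnack_dichotomy[OF g _ that] by (meson less_imp_le not_le)
      have z1: "1 \<le> norm z" and z0: "0 < norm z" using elim(6) by linarith+
      \<comment> \<open>Bounds by powers of |\<zeta>| become bounds by powers of |z|, with the
        exponent doubled.\<close>
      have disc: "\<rho> \<le> norm \<zeta>" "norm \<zeta> \<le> norm z ^ 2" if "dist z \<zeta> \<le> 1" for \<zeta>
      proof -
        have "norm z \<le> norm \<zeta> + 1" "norm \<zeta> \<le> norm z + 1"
          using that norm_triangle_ineq2[of z \<zeta>] norm_triangle_ineq3[of z \<zeta>] by (auto simp: dist_norm)
        moreover have "norm z + 1 \<le> norm z * 2" using z1 by simp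
        moreover have "norm z * 2 \<le> norm z * norm z" using elim(6) by (intro mult_left_mono) auto
        ultimately show "\<rho> \<le> norm \<zeta>" "norm \<zeta> \<le> norm z ^ 2"
          using elim(5) by (auto simp: power2_eq_square)
      qed
      have small: "norm (eval2 Q \<zeta> (w \<zeta>)) * norm z ^ N \<le> 1" if "dist z \<zeta> \<le> 1" for \<zeta>
      proof -
        have "Re (g \<zeta>) \<le> - (real (2 * l + N) * ln (norm z))"
        proof -
          have "C * ln (norm z) = 2 * (real (2 * l + N) * ln (norm z))" by (simp add: C_def)
          then show ?thesis using half[OF that] big by linarith
        qed
        then have "norm (exp (g \<zeta>)) \<le> exp (- (real (2 * l + N) * ln (norm z)))" by simp
        also have "\<dots> = inverse (norm z ^ (2 * l + N))"
          unfolding exp_minus exp_nat_mult_ln[OF z0] ..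
        finally have 1: "norm (exp (g \<zeta>)) \<le> inverse (norm z ^ (2 * l + N))" .
        have "norm (ratfun_eval r \<zeta>) \<le> norm \<zeta> ^ l" using \<rho>(2) disc(1)[OF that] by blast
        also have "\<dots> \<le> (norm z ^ 2) ^ l" using disc(2)[OF that] by (intro power_mono) auto
        finally have 2: "norm (ratfun_eval r \<zeta>) \<le> norm z ^ (2 * l)" by (simp add: power_mult)
        have "norm (eval2 Q \<zeta> (w \<zeta>)) \<le> norm z ^ (2 * l) * inverse (norm z ^ (2 * l + N))"
          unfolding \<rho>(3)[OF disc(1)[OF that]] norm_mult using 1 2 by (intro mult_mono) auto
        also have "\<dots> = inverse (norm z ^ N)" using z0 by (simp add: power_add)
        finally show ?thesis using z0 by (simp add: field_simps)
      qed
      define W where "W = norm z ^ (2 * k)"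
      have W1: "1 \<le> W" unfolding W_def by (rule one_le_power[OF z1])
      have wW: "norm (w \<zeta>) \<le> W" if "dist z \<zeta> \<le> 1" for \<zeta>
      proof -
        \<comment> \<open>Smallness of Q(\<zeta>,w(\<zeta>)) is used here only in the form \<le> 1,
          which by the choice of k bounds w(\<zeta>).\<close>
        have "norm (eval2 Q \<zeta> (w \<zeta>)) * 1 \<le> norm (eval2 Q \<zeta> (w \<zeta>)) * norm z ^ N"
          by (intro mult_left_mono one_le_power z1) simp
        then have "norm (eval2 Q \<zeta> (w \<zeta>)) \<le> 1" using small[OF that] by simp
        then have "norm (w \<zeta>) \<le> norm \<zeta> ^ k" using \<rho>(1) disc(1)[OF that] by blast
        also have "\<dots> \<le> (norm z ^ 2) ^ k" using disc(2)[OF that] by (intro power_mono) auto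
        finally show ?thesis by (simp add: power_mult W_def)
      qed
      have dW: "norm (deriv w z) \<le> W" by (rule norm_deriv_le[OF w(1) wW])
      have "norm (w (z + 1) - w (z - 1)) \<le> W + W"
        using norm_triangle_ineq4[of "w (z + 1)" "w (z - 1)"] wW[of "z + 1"] wW[of "z - 1"] by (simp add: dist_norm)
      then have "norm (w z * (w (z + 1) - w (z - 1))) \<le> W * (W + W)"
        unfolding norm_mult using wW[of z] W1 by (intro mult_mono) auto
      moreover have "norm (ratfun_eval a z * deriv w z) \<le> norm z ^ m * (W * W)"
      proof -
        have "W * 1 \<le> W * W" using W1 by (intro mult_left_mono) auto
        then have "norm (deriv w z) \<le> W * W" using dW by linarith
        then show ?thesis unfolding norm_mult using elim(1) by (intro mult_mono) auto
      qed
      ultimately have "norm (F z) \<le> 2 * (W * W) + norm z ^ m * (W * W)"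
        unfolding F_def by (intro norm_triangle_le) simp
      also have "\<dots> \<le> 2 * (norm z ^ m * (W * W)) + norm z ^ m * (W * W)"
        using mult_right_mono[OF one_le_power[OF z1, of m], of "W * W"] W1 by simp
      finally have F: "norm (F z) \<le> 3 * norm z ^ (4 * k + m)"
        by (simp add: W_def power_add[symmetric] add.commute)
      have mW: "max 1 (norm (w z)) \<le> W" using wW[of z] W1 by simp
      have "norm (eval2 A z (w z)) \<le> norm z ^ i * max 1 (norm (w z)) ^ degree A" using elim(2) by blast
      also have "\<dots> \<le> norm z ^ i * W ^ degree A" using mW by (intro mult_left_mono power_mono) auto
      finally have A: "norm (eval2 A z (w z)) \<le> norm z ^ (i + 2 * k * degree A)"
        by (simp add: W_def power_add power_mult)
      have "norm (eval2 B z (w z)) \<le> norm z ^ j * max 1 (norm (w z)) ^ degree B" using elim(3) by blast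
      also have "\<dots> \<le> norm z ^ j * W ^ degree B" using mW by (intro mult_left_mono power_mono) auto
      finally have B: "norm (eval2 B z (w z)) \<le> norm z ^ (j + 2 * k * degree B)"
        by (simp add: W_def power_add power_mult)
      have "norm (eval2 A z (w z) * F z + eval2 B z (w z))
          \<le> norm z ^ (i + 2 * k * degree A) * (3 * norm z ^ (4 * k + m)) + norm z ^ (j + 2 * k * degree B)"
        by (intro norm_triangle_le add_mono) (auto simp: norm_mult intro!: mult_mono A F B)
      also have "\<dots> = 3 * norm z ^ (i + 2 * k * degree A + 4 * k + m) + norm z ^ (j + 2 * k * degree B)"
        by (simp add: power_add)
      also have "\<dots> \<le> 3 * norm z ^ e + norm z ^ e"
        using z1 by (intro add_mono mult_left_mono power_increasing) (auto simp: e_def)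
      also have "\<dots> < 8 * norm z ^ e" using z0 by simp
      also have "\<dots> \<le> norm z ^ 3 * norm z ^ e"
        using power_mono[of 2 "norm z" 3] elim(6) by (intro mult_right_mono) auto
      finally have bd: "norm (eval2 A z (w z) * F z + eval2 B z (w z)) < norm z ^ N"
        by (simp add: N_def power_add mult_ac)
      have "eval2 Q z (w z) \<noteq> 0" using elim(4) by auto
      \<comment> \<open>The two factors in \<open>unit\<close> would have product of modulus less
        than |z|^(-N) |z|^N = 1.\<close>
      have "1 = norm (eval2 Q z (w z)) * norm (eval2 A z (w z) * F z + eval2 B z (w z))"
        using elim(4) by (metis norm_mult norm_one)
      also have "\<dots> < norm (eval2 Q z (w z)) * norm z ^ N"
        using bd \<open>eval2 Q z (w z) \<noteq> 0\<close> by (intro mult_strict_left_mono) auto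
      also have "\<dots> \<le> 1" by (rule small) simp
      finally show False by simp
    qed
  qed
  then have "\<forall>\<^sub>F z in at_infinity. - Re (g z) \<le> C * ln (norm z)"
    by (intro logarithmic_bound_of_growth[OF \<tau>, of "3 / 2" 3]) (auto simp: C_def N_def)
  then have "\<forall>\<^sub>F z in at_infinity. norm (exp (- g z)) \<le> norm z ^ (2 * (2 * l + N))"
    using norm_ge_at_infinity[of 1]
  proof eventually_elim
    case (elim z)
    have "norm (exp (- g z)) \<le> exp (C * ln (norm z))" using elim(1) by simp
    also have "\<dots> = norm z ^ (2 * (2 * l + N))"
      unfolding C_def using elim(2) by (intro exp_nat_mult_ln) linarith
    finally show ?case .
  qed
  then have "poly_bounded (\<lambda>z. exp (- g z))" by (rule poly_boundedI)
  moreover have "(\<lambda>z. exp (- g z)) holomorphic_on UNIV" by (intro holomorphic_intros g)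
  ultimately obtain p where p: "\<And>z. exp (- g z) = poly p z" using entire_poly_bounded by blast
  \<comment> \<open>exp (- g) is a polynomial without zeros, hence constant by the fundamental
    theorem of algebra.\<close>
  have "constant (poly p)"
    using fundamental_theorem_of_algebra[of p] p by (metis exp_not_eq_zero)
  then have "exp (- g z) = exp (- g 0)" for z unfolding p constant_def by blast
  then have gconst: "exp (g z) = exp (g 0)" for z by (metis add.inverse_inverse exp_minus)
  have "\<forall>\<^sub>F z in at_infinity. eval2 Q z (w z) = ratfun_eval (r * Fraction_Field.Fract [:exp (g 0):] 1) z"
    using Qeq ratfun_eval_mult[of r "Fraction_Field.Fract [:exp (g 0):] 1"]
  proof eventually_elim
    case (elim z)
    have "ratfun_eval (Fraction_Field.Fract [:exp (g 0):] 1) z = exp (g 0)"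
      by (subst ratfun_eval_Fract) auto
    then show ?case by (simp only: elim gconst[of z])
  qed
  then show False using not_root_ratfun[OF w dQ] by blast
qed

section \<open>From the given equation to a polynomial right side\<close>

lemma cleared_equation:
  assumes w: "w holomorphic_on UNIV" "transcendental w" and Q: "Q \<noteq> 0"
    and eq: "\<forall>\<^sub>\<approx>z\<in>UNIV. w (z + 1) - w (z - 1) + ratfun_eval a z * (deriv w z / w z)
                  = eval2 P z (w z) / eval2 Q z (w z)"
  shows "\<forall>\<^sub>F z in at_infinity. (w z * (w (z + 1) - w (z - 1)) + ratfun_eval a z * deriv w z) * eval2 Q z (w z)
               = w z * eval2 P z (w z)"
proof -
  note ent = holomorphic_near_infinity_entire
  have sh: "(\<lambda>z. w (z + c)) holomorphic_on UNIV" for c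
    by (rule holomorphic_on_compose_gen[OF _ w(1), unfolded o_def]) (auto intro!: holomorphic_intros)
  have sh': "(\<lambda>z. w (z - c)) holomorphic_on UNIV" for c using sh[of "- c"] by simp
  have dw: "deriv w holomorphic_on UNIV" by (rule holomorphic_deriv[OF w(1) open_UNIV])
  have "\<forall>\<^sub>F z in at_infinity. (w z * (w (z + 1) - w (z - 1)) + ratfun_eval a z * deriv w z) * eval2 Q z (w z)
               - w z * eval2 P z (w z) = 0"
  \<comment> \<open>Where w Q(z,w) is not 0 the divisions in the equation are genuine and can be
    cleared. The product w Q(z,w) is the evaluation of the nonzero polynomial
    \<open>pCons 0 Q\<close>, so it does not vanish identically near infinity.\<close>
  proof (rule vanish_near_infinity[where G = "\<lambda>z. w z * eval2 Q z (w z)" and b = 0])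
    show "holomorphic_near_infinity (\<lambda>z. w z * eval2 Q z (w z))"
      by (intro holomorphic_near_infinity_mult holomorphic_near_infinity_eval2 ent w)
    show "holomorphic_near_infinity (\<lambda>z. (w z * (w (z + 1) - w (z - 1)) + ratfun_eval a z * deriv w z) * eval2 Q z (w z)
               - w z * eval2 P z (w z))"
      by (intro holomorphic_near_infinity_mult holomorphic_near_infinity_diff holomorphic_near_infinity_add
          holomorphic_near_infinity_eval2 holomorphic_near_infinity_ratfun_eval ent[OF w(1)] ent[OF sh] ent[OF sh'] ent[OF dw])
    show "\<not> (\<forall>\<^sub>F z in at_infinity. w z * eval2 Q z (w z) = 0)"
      using transcendental_not_root[OF w, of "pCons 0 Q"] Q by simp
    fix z0 :: complex
    have "\<forall>\<^sub>F z in at z0. w (z + 1) - w (z - 1) + ratfun_eval a z * (deriv w z / w z) = eval2 P z (w z) / eval2 Q z (w z)"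
      using eq by (rule eventually_cosparse_imp_eventually_at) simp
    then show "\<forall>\<^sub>F z in at z0. w z * eval2 Q z (w z) \<noteq> 0 \<longrightarrow>
        (w z * (w (z + 1) - w (z - 1)) + ratfun_eval a z * deriv w z) * eval2 Q z (w z) - w z * eval2 P z (w z) = 0"
    proof eventually_elim
      case (elim z)
      show ?case
      proof
        assume nz: "w z * eval2 Q z (w z) \<noteq> 0"
        have "(w z * (w (z + 1) - w (z - 1)) + ratfun_eval a z * deriv w z)
            = w z * (w (z + 1) - w (z - 1) + ratfun_eval a z * (deriv w z / w z))"
          using nz by (simp add: distrib_left)
        then show "(w z * (w (z + 1) - w (z - 1)) + ratfun_eval a z * deriv w z) * eval2 Q z (w z) - w z * eval2 P z (w z) = 0"
          using nz unfolding elim by simp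
      qed
    qed
  qed
  then show ?thesis by eventually_elim simp
qed

text \<open>G(z,w(z)) does not vanish identically near infinity because w is transcendental, so it
  can be cancelled off its zeros; the identity theorem supplies the rest.\<close>

lemma cancel_common_factor:
  assumes w: "w holomorphic_on UNIV" "transcendental w"
    and F: "holomorphic_near_infinity F" and G: "G \<noteq> 0"
    and eq: "\<forall>\<^sub>F z in at_infinity. F z * eval2 (G * Q) z (w z) = eval2 (G * P) z (w z)"
  shows "\<forall>\<^sub>F z in at_infinity. F z * eval2 Q z (w z) = eval2 P z (w z)"
proof -
  have "\<forall>\<^sub>F z in at_infinity. eval2 G z (w z) \<noteq> 0 \<longrightarrow> F z * eval2 Q z (w z) - eval2 P z (w z) = 0"
    using eq eval2_mult[of G Q] eval2_mult[of G P]
  proof eventually_elim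
    case (elim z)
    then have "eval2 G z (w z) * (F z * eval2 Q z (w z)) = eval2 G z (w z) * eval2 P z (w z)"
      by (simp add: mult_ac)
    then show ?case by auto
  qed
  then obtain \<rho> where \<rho>: "\<And>z0. \<rho> < norm z0 \<Longrightarrow>
      \<forall>\<^sub>F z in at z0. eval2 G z (w z) \<noteq> 0 \<longrightarrow> F z * eval2 Q z (w z) - eval2 P z (w z) = 0"
    by (rule eventually_at_infinity_imp_at) blast
  have "\<forall>\<^sub>F z in at_infinity. F z * eval2 Q z (w z) - eval2 P z (w z) = 0"
    by (rule vanish_near_infinity[OF _ _ transcendental_not_root[OF w G] \<rho>])
       (intro holomorphic_near_infinity_mult holomorphic_near_infinity_diff holomorphic_near_infinity_eval2
         holomorphic_near_infinity_entire w(1) F)+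
  then show ?thesis by eventually_elim simp
qed

theorem theorem1p1:
  fixes R :: "ratfun poly fract" and P Q :: "ratfun poly"
    and a :: ratfun and w :: "complex \<Rightarrow> complex"
  assumes "R = Fraction_Field.Fract P Q" and "Q \<noteq> 0" and "coprime P Q" and "R \<noteq> 0"
    and "w holomorphic_on UNIV" and "transcendental w" and "hyper_order w < 1"
    and "\<forall>\<^sub>\<approx>z\<in>UNIV. w (z + 1) - w (z - 1) + ratfun_eval a z * (deriv w z / w z)
                  = eval2 P z (w z) / eval2 Q z (w z)"
  shows "(\<exists>a1 a0 :: ratfun. R = Fraction_Field.Fract [:a0, a1:] 1) \<or>
         (\<exists>a2 a1 a0 :: ratfun. R = Fraction_Field.Fract [:a0, a1, a2:] [:0, 1:])"
proof -
  note w = assms(5,6)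
  obtain \<sigma> where \<sigma>: "0 < \<sigma>" "\<sigma> < 1"
      "\<forall>\<^sub>F s in at_top. \<forall>z. norm z \<le> s \<longrightarrow> ln (norm (w z)) \<le> exp (s powr \<sigma>)"
    by (rule ln_norm_growth[OF assms(5,7)])
  define F where "F = (\<lambda>z. w z * (w (z + 1) - w (z - 1)) + ratfun_eval a z * deriv w z)"
  have "(\<lambda>z. w (z + c)) holomorphic_on UNIV" for c
    by (rule holomorphic_on_compose_gen[OF _ w(1), unfolded o_def]) (auto intro!: holomorphic_intros)
  from this[of 1] this[of "-1"] have F: "holomorphic_near_infinity F"
    unfolding F_def
    by (intro holomorphic_near_infinity_mult holomorphic_near_infinity_diff holomorphic_near_infinity_add
        holomorphic_near_infinity_ratfun_eval holomorphic_near_infinity_entire w(1) holomorphic_deriv) auto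
  have eq: "\<forall>\<^sub>F z in at_infinity. F z * eval2 Q z (w z) = eval2 (pCons 0 P) z (w z)"
    using cleared_equation[OF w assms(2,8)] by (simp add: F_def)
  \<comment> \<open>P and Q are coprime, but w P and Q may still share the factor w, so the fraction
    w P / Q is reduced anew.\<close>
  obtain G A B P1 Q1 where red: "pCons 0 P = G * P1" "Q = G * Q1" "A * P1 + B * Q1 = 1"
    by (rule reduce_fraction[OF assms(2)])
  have "G \<noteq> 0" using red(2) assms(2) by auto
  have eq1: "\<forall>\<^sub>F z in at_infinity. F z * eval2 Q1 z (w z) = eval2 P1 z (w z)"
    by (rule cancel_common_factor[OF w F \<open>G \<noteq> 0\<close>]) (use eq red in simp)
  have "degree Q1 = 0"
    by (rule denominator_constant[OF w \<sigma> _ red(3)]) (use eq1 in \<open>simp add: F_def\<close>)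
  then obtain c where c: "Q1 = [:c:]" by (rule degree_eq_zeroE)
  have "c \<noteq> 0" using c red(2) assms(2) by auto
  \<comment> \<open>As Q1 is a constant in w, dividing by it makes the right side of the equation
    for F a polynomial in w.\<close>
  define S where "S = smult (inverse c) P1"
  have "\<forall>\<^sub>F z in at_infinity. F z = eval2 S z (w z)"
    using eq1 eval2_smult[of "inverse c" P1] ratfun_eval_mult[of "inverse c" c]
  proof eventually_elim
    case (elim z)
    have one: "ratfun_eval (inverse c) z * ratfun_eval c z = 1"
      using elim(3) \<open>c \<noteq> 0\<close> by simp
    have "eval2 S z (w z) = ratfun_eval (inverse c) z * (F z * ratfun_eval c z)"
      using elim(1,2) by (simp add: S_def c)
    also have "\<dots> = F z * (ratfun_eval (inverse c) z * ratfun_eval c z)" by (simp only: mult_ac)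
    finally show ?case unfolding one by simp
  qed
  then have "degree S \<le> 2" by (intro degree_le_2[OF w \<sigma>]) (simp add: F_def)
  then have S: "S = [:coeff S 0, coeff S 1, coeff S 2:]"
    by (intro poly_eqI) (auto simp: coeff_pCons coeff_eq_0 numeral_2_eq_2 split: nat.split)
  have "P * [:0, 1:] = S * Q"
  proof -
    have "P * [:0, 1:] = pCons 0 P" by simp
    also have "\<dots> = S * Q" using \<open>c \<noteq> 0\<close> unfolding red(1) S_def by (simp add: red(2) c mult.commute)
    finally show ?thesis .
  qed
  then have "R = Fraction_Field.Fract S [:0, 1:]" using assms(1,2) by (simp add: eq_fract)
  then show ?thesis using S by metis
qed

end
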